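(* Let $\alpha=(\alpha_1,\dots,\alpha_k)$ be a composition of $n$ and let $A,B$ be complementary subsets of $[k]$ ($A\cup B=[k]$, $A\cap B=\emptyset$). Let $N(\alpha,A,B)$ (resp. $N^*(\alpha,A,B)$) be the number of $(A,B)$-alternating (resp. reverse $(A,B)$-alternating) $\alpha$-permutations. (a) If $n$ is odd, then $N(\alpha,A,B)=N^*(\alpha,A,B)=\left(\prod_{i\in A}e_{\alpha_i}\prod_{j\in B}h_{\alpha_j}\right)[E,0,-E,0,E,0,-E,0,\dots]$. (b) If $n$ is even, then $N(\alpha,A,B)=\left(\prod_{i\in A}e_{\alpha_i}\prod_{j\in B}h_{\alpha_j}\right)[E,-1,-E,1,E,-1,-E,1,\dots]$ and $N^*(\alpha,A,B)=\left(\prod_{i\in A}e_{\alpha_i}\prod_{j\in B}h_{\alpha_j}\right)[E,1,-E,-1,E,1,-E,-1,\dots]$. All right-hand sides are evaluated umbrally.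
   Context: An $\alpha$-permutation is a sequence $a_1a_2\cdots a_n$ containing exactly $\alpha_i$ occurrences of $i$ for $1\le i\le k$. Comparisons between equal values are decided by $A,B$: declare $j>j$ if $j\in A$ and $j<j$ if $j\in B$ (distinct values compare as usual). The $\alpha$-permutation is $(A,B)$-alternating if $a_1>a_2<a_3>a_4<\cdots$ and reverse $(A,B)$-alternating if $a_1<a_2>a_3<a_4>\cdots$, under this convention. $e_i$ and $h_i$ are the elementary and complete homogeneous symmetric functions. Substitution: $f[a_1,a_2,\dots]$ means write $f$ as a polynomial in the power sums $p_i$ and set $p_i=a_i$; $[E,0,-E,0,\dots]$: $p_{2j+1}=(-1)^jE$, $p_{2j}=0$; $[E,-1,-E,1,\dots]$: $p_{2j+1}=(-1)^jE$, $p_{2j}=(-1)^j$; $[E,1,-E,-1,\dots]$: $p_{2j+1}=(-1)^jE$, $p_{2j}=(-1)^{j+1}$. Euler numbers $E_n$: $\sum E_nx^n/n!=\sec x+\tan x$. Umbral evaluation: expand the polynomial in the indeterminate $E$ in powers of $E$, then replace each $E^k$ by $E_k$ as the last step. *)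

theory Defs
  imports
    "HOL-Library.Poly_Mapping"
    "HOL-Computational_Algebra.Computational_Algebra"
begin

text \<open>
  Formal power series with rational coefficients in the variables \<open>x\<^sub>0, x\<^sub>1, x\<^sub>2, \<dots>\<close>,
  the ambient ring of the symmetric functions.  A monomial is the finitely supported
  function giving the exponent of each variable.
\<close>

typedef xseries = "UNIV :: ((nat \<Rightarrow>\<^sub>0 nat) \<Rightarrow> rat) set"
  morphisms xcoeff XSeries ..

setup_lifting type_definition_xseries

definition splits :: "(nat \<Rightarrow>\<^sub>0 nat) \<Rightarrow> ((nat \<Rightarrow>\<^sub>0 nat) \<times> (nat \<Rightarrow>\<^sub>0 nat)) set" where
  "splits m = {(a, b). a + b = m}"

lemma finite_splits [simp]: "finite (splits m)"
proof -
  let ?K = "Poly_Mapping.keys m"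
  let ?M = "{..Max (insert 0 (Poly_Mapping.lookup m ` ?K))}"
  let ?F = "{f. \<forall>x. (x \<in> ?K \<longrightarrow> f x \<in> ?M) \<and> (x \<notin> ?K \<longrightarrow> f x = (0::nat))}"
  have "finite ?F"
    by (rule finite_set_of_finite_funs) auto
  moreover have "Poly_Mapping.lookup ` fst ` splits m \<subseteq> ?F"
  proof (clarsimp simp: splits_def, intro conjI allI impI)
    fix a b :: "nat \<Rightarrow>\<^sub>0 nat" and x
    { assume "x \<in> Poly_Mapping.keys (a + b)"
      then have "Poly_Mapping.lookup (a + b) x
          \<le> Max (insert 0 (Poly_Mapping.lookup (a + b) ` Poly_Mapping.keys (a + b)))"
        by (intro Max_ge) auto
      then show "Poly_Mapping.lookup a x
          \<le> Max (insert 0 (Poly_Mapping.lookup (a + b) ` Poly_Mapping.keys (a + b)))"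
        by (simp add: lookup_add) }
    { assume "x \<notin> Poly_Mapping.keys (a + b)"
      then show "Poly_Mapping.lookup a x = 0"
        by (simp add: in_keys_iff lookup_add) }
  qed
  ultimately have "finite (Poly_Mapping.lookup ` fst ` splits m)"
    by (rule finite_subset[rotated])
  moreover have "inj (Poly_Mapping.lookup :: (nat \<Rightarrow>\<^sub>0 nat) \<Rightarrow> _)"
    by (simp add: inj_def)
  ultimately have "finite (fst ` splits m)"
    by (meson finite_imageD inj_on_subset subset_UNIV)
  moreover have "inj_on fst (splits m)"
    by (auto simp: inj_on_def splits_def)
  ultimately show ?thesis
    by (rule finite_imageD)
qed

instantiation xseries :: comm_ring_1
begin

lift_definition zero_xseries :: xseries is "\<lambda>_. 0" .

lift_definition one_xseries :: xseries is "\<lambda>m. if m = 0 then 1 else 0" .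

lift_definition plus_xseries :: "xseries \<Rightarrow> xseries \<Rightarrow> xseries" is "\<lambda>f g m. f m + g m" .

lift_definition uminus_xseries :: "xseries \<Rightarrow> xseries" is "\<lambda>f m. - f m" .

lift_definition minus_xseries :: "xseries \<Rightarrow> xseries \<Rightarrow> xseries" is "\<lambda>f g m. f m - g m" .

lift_definition times_xseries :: "xseries \<Rightarrow> xseries \<Rightarrow> xseries"
  is "\<lambda>f g m. \<Sum>(a, b)\<in>splits m. f a * g b" .

instance
proof
  fix f g h :: xseries
  show "f * g * h = f * (g * h)"
  proof (transfer, rule ext)
    fix f g h :: "(nat \<Rightarrow>\<^sub>0 nat) \<Rightarrow> rat" and m
    have "(\<Sum>(u, c)\<in>splits m. (\<Sum>(a, b)\<in>splits u. f a * g b) * h c)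
        = (\<Sum>p\<in>splits m. \<Sum>q\<in>splits (fst p). f (fst q) * g (snd q) * h (snd p))"
      by (simp add: sum_distrib_right case_prod_beta)
    also have "\<dots> = (\<Sum>(p, q)\<in>Sigma (splits m) (\<lambda>p. splits (fst p)).
        f (fst q) * g (snd q) * h (snd p))"
      by (rule sum.Sigma) auto
    also have "\<dots> = (\<Sum>(p, q)\<in>Sigma (splits m) (\<lambda>p. splits (snd p)).
        f (fst p) * (g (fst q) * h (snd q)))"
      by (rule sum.reindex_bij_witness
          [where i = "\<lambda>(p, q). ((fst p + fst q, snd q), (fst p, fst q))"
             and j = "\<lambda>(p, q). ((fst q, snd q + snd p), (snd q, snd p))"])
         (auto simp: splits_def add.assoc)
    also have "\<dots> = (\<Sum>p\<in>splits m. \<Sum>q\<in>splits (snd p). f (fst p) * (g (fst q) * h (snd q)))"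
      by (rule sum.Sigma[symmetric]) auto
    also have "\<dots> = (\<Sum>(a, v)\<in>splits m. f a * (\<Sum>(b, c)\<in>splits v. g b * h c))"
      by (simp add: sum_distrib_left case_prod_beta)
    finally show "(\<Sum>(u, c)\<in>splits m. (\<Sum>(a, b)\<in>splits u. f a * g b) * h c)
        = (\<Sum>(a, v)\<in>splits m. f a * (\<Sum>(b, c)\<in>splits v. g b * h c))" .
  qed
  show "f * g = g * f"
  proof (transfer, rule ext)
    fix f g :: "(nat \<Rightarrow>\<^sub>0 nat) \<Rightarrow> rat" and m
    show "(\<Sum>(a, b)\<in>splits m. f a * g b) = (\<Sum>(a, b)\<in>splits m. g a * f b)"
      by (rule sum.reindex_bij_witness[where i = prod.swap and j = prod.swap])
         (auto simp: splits_def add.commute)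
  qed
  show "1 * f = f"
  proof (transfer, rule ext)
    fix f :: "(nat \<Rightarrow>\<^sub>0 nat) \<Rightarrow> rat" and m
    have "(\<Sum>(a, b)\<in>splits m. (if a = 0 then 1 else 0) * f b)
        = (\<Sum>(a, b)\<in>{(0 :: nat \<Rightarrow>\<^sub>0 nat, m)}. (if a = 0 then 1 else 0) * f b)"
      by (rule sum.mono_neutral_right, simp) (auto simp: splits_def split: if_splits)
    then show "(\<Sum>(a, b)\<in>splits m. (if a = 0 then 1 else 0) * f b) = f m"
      by simp
  qed
  show "(f + g) * h = f * h + g * h"
    by transfer (simp add: case_prod_beta sum.distrib distrib_right)
  show "(0::xseries) \<noteq> 1"
    by transfer (auto simp: fun_eq_iff intro!: exI[of _ 0])
  show "f + g + h = f + (g + h)"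
    by transfer (simp add: add.assoc)
  show "f + g = g + f"
    by transfer (simp add: add.commute)
  show "0 + f = f"
    by transfer simp
  show "- f + f = 0"
    by transfer simp
  show "f - g = f + - g"
    by transfer simp
qed

end

lift_definition xconst :: "rat \<Rightarrow> xseries" is "\<lambda>c m. if m = 0 then c else 0" .

definition mdegree :: "(nat \<Rightarrow>\<^sub>0 nat) \<Rightarrow> nat" where
  "mdegree m = (\<Sum>i\<in>Poly_Mapping.keys m. Poly_Mapping.lookup m i)"

text \<open>
  The elementary, complete homogeneous and power sum symmetric functions;
  \<open>sym_p r\<close> is only meaningful for \<open>r \<ge> 1\<close>.
\<close>

lift_definition sym_e :: "nat \<Rightarrow> xseries"
  is "\<lambda>r m. if mdegree m = r \<and> (\<forall>i. Poly_Mapping.lookup m i \<le> 1) then 1 else 0" .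

lift_definition sym_h :: "nat \<Rightarrow> xseries"
  is "\<lambda>r m. if mdegree m = r then 1 else 0" .

lift_definition sym_p :: "nat \<Rightarrow> xseries"
  is "\<lambda>r m. if \<exists>i. m = Poly_Mapping.single i r then 1 else 0" .

text \<open>
  Value of a multivariate polynomial over the rationals, encoded as a finitely supported
  function from monomials to coefficients, when variable number \<open>i\<close> is set to \<open>v i\<close>;
  the map \<open>c\<close> embeds the coefficients into the target ring.
\<close>

definition eval_mpoly ::
  "(rat \<Rightarrow> 'a::comm_ring_1) \<Rightarrow> (nat \<Rightarrow> 'a) \<Rightarrow> ((nat \<Rightarrow>\<^sub>0 nat) \<Rightarrow>\<^sub>0 rat) \<Rightarrow> 'a" where
  "eval_mpoly c v P =
     (\<Sum>m\<in>Poly_Mapping.keys P. c (Poly_Mapping.lookup P m) *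
        (\<Prod>i\<in>Poly_Mapping.keys m. v i ^ Poly_Mapping.lookup m i))"

text \<open>
  \<open>P\<close> writes \<open>f\<close> as a polynomial in \<open>p\<^sub>1, p\<^sub>2, \<dots>\<close>: variable number \<open>i\<close> stands for \<open>p\<^sub>i\<close>, and
  variable number \<open>0\<close> must not occur.
\<close>

definition power_sum_expansion :: "xseries \<Rightarrow> ((nat \<Rightarrow>\<^sub>0 nat) \<Rightarrow>\<^sub>0 rat) \<Rightarrow> bool" where
  "power_sum_expansion f P \<longleftrightarrow>
     (\<forall>m\<in>Poly_Mapping.keys P. 0 \<notin> Poly_Mapping.keys m) \<and> eval_mpoly xconst sym_p P = f"

text \<open>
  The substitution \<open>f[a\<^sub>1, a\<^sub>2, \<dots>]\<close> with values in the polynomials over the rationals in the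
  umbral indeterminate \<open>E\<close>.  The expansion is unique because the power sums are
  algebraically independent; the value of \<open>a\<close> at \<open>0\<close> plays no role.
\<close>

definition psubst :: "xseries \<Rightarrow> (nat \<Rightarrow> rat poly) \<Rightarrow> rat poly" where
  "psubst f a = eval_mpoly (\<lambda>q. [:q:]) a (THE P. power_sum_expansion f P)"

definition umbral_E :: "rat poly" where
  "umbral_E = [:0, 1:]"

definition seq_zero :: "nat \<Rightarrow> rat poly" where \<comment> \<open>\<open>E, 0, -E, 0, \<dots>\<close>\<close>
  "seq_zero i = (if odd i then (-1) ^ (i div 2) * umbral_E else 0)"

definition seq_minus :: "nat \<Rightarrow> rat poly" where \<comment> \<open>\<open>E, -1, -E, 1, \<dots>\<close>\<close>
  "seq_minus i = (if odd i then (-1) ^ (i div 2) * umbral_E else (-1) ^ (i div 2))"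

definition seq_plus :: "nat \<Rightarrow> rat poly" where \<comment> \<open>\<open>E, 1, -E, -1, \<dots>\<close>\<close>
  "seq_plus i = (if odd i then (-1) ^ (i div 2) * umbral_E else (-1) ^ (i div 2 + 1))"

definition euler_number :: "nat \<Rightarrow> rat" where
  "euler_number n = fact n * fps_nth (inverse (fps_cos 1) + fps_tan 1) n"

definition umbral :: "rat poly \<Rightarrow> rat" where
  "umbral q = (\<Sum>i\<le>degree q. coeff q i * euler_number i)"

definition alpha_perms :: "nat \<Rightarrow> (nat \<Rightarrow> nat) \<Rightarrow> nat list set" where
  "alpha_perms k \<alpha> = {w. set w \<subseteq> {1..k} \<and> (\<forall>i\<in>{1..k}. count_list w i = \<alpha> i)}"

definition gt_conv :: "nat set \<Rightarrow> nat \<Rightarrow> nat \<Rightarrow> bool" where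
  "gt_conv A i j \<longleftrightarrow> i > j \<or> (i = j \<and> j \<in> A)"

definition lt_conv :: "nat set \<Rightarrow> nat \<Rightarrow> nat \<Rightarrow> bool" where
  "lt_conv B i j \<longleftrightarrow> i < j \<or> (i = j \<and> j \<in> B)"

text \<open>List positions count from \<open>0\<close>, so \<open>a\<^sub>1 > a\<^sub>2\<close> is the comparison at the even position \<open>0\<close>.\<close>

definition alternating :: "nat set \<Rightarrow> nat set \<Rightarrow> nat list \<Rightarrow> bool" where
  "alternating A B w \<longleftrightarrow>
     (\<forall>i. Suc i < length w \<longrightarrow>
        (if even i then gt_conv A (w ! i) (w ! Suc i) else lt_conv B (w ! i) (w ! Suc i)))"

definition rev_alternating :: "nat set \<Rightarrow> nat set \<Rightarrow> nat list \<Rightarrow> bool" where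
  "rev_alternating A B w \<longleftrightarrow>
     (\<forall>i. Suc i < length w \<longrightarrow>
        (if even i then lt_conv B (w ! i) (w ! Suc i) else gt_conv A (w ! i) (w ! Suc i)))"

definition num_alt :: "nat \<Rightarrow> (nat \<Rightarrow> nat) \<Rightarrow> nat set \<Rightarrow> nat set \<Rightarrow> nat" where
  "num_alt k \<alpha> A B = card {w \<in> alpha_perms k \<alpha>. alternating A B w}"

definition num_rev_alt :: "nat \<Rightarrow> (nat \<Rightarrow> nat) \<Rightarrow> nat set \<Rightarrow> nat set \<Rightarrow> nat" where
  "num_rev_alt k \<alpha> A B = card {w \<in> alpha_perms k \<alpha>. rev_alternating A B w}"

end

theory Submission
  imports Defs
begin

text \<open>
  Let \<open>y\<^sub>a\<close> be the generating function of the alternating words that are empty or start with a letter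
  greater than \<open>a\<close>, and \<open>x\<^sub>a\<close> that of the reverse alternating words that are empty or start with a
  letter at most \<open>a\<close>, in variables \<open>t\<^sub>1, \<dots>, t\<^sub>k\<close> marking the letters. Removing the first letter shows
  that \<open>z\<^sub>a = y\<^sub>a + \<i> x\<^sub>a\<close> satisfies \<open>z\<^sub>a = (1 + \<i> t\<^sub>a) z\<^bsub>a-1\<^esub>\<close> for \<open>a \<in> B\<close> and
  \<open>(1 - \<i> t\<^sub>a) z\<^sub>a = z\<^bsub>a-1\<^esub>\<close> for \<open>a \<in> A\<close>, while \<open>x\<^sub>0 = y\<^sub>k = 1\<close>. With \<open>C + \<i> S\<close> the product of all
  \<open>1 + \<i> t\<^sub>j\<close> and \<open>D\<close> the product of the \<open>1 + t\<^sub>j\<^sup>2\<close> over \<open>A\<close>, this yields \<open>C y\<^sub>0 = D + S\<close>.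

  On the umbral side, Newton's identities show that the images of \<open>e\<^sub>n\<close> and \<open>h\<^sub>n\<close> are the coefficients
  of \<open>(1 + t\<^sup>2)\<^bsup>\<kappa>/2\<^esup> exp (E arctan t)\<close> with \<open>\<kappa> \<in> {-1, 0, 1}\<close>. Multiplying this series by \<open>1 + \<i> t\<close>
  replaces \<open>(\<kappa>, E)\<close> by \<open>(\<kappa> + 1, E + \<i>)\<close>, and \<open>cos x (sec x + tan x) = 1 + sin x\<close> says that the
  umbral value of \<open>Re q(E + \<i>)\<close> is \<open>q(0) + Im q(\<i>)\<close>. Hence the right-hand sides satisfy the same linear
  equation in the relevant parity, and it has a unique solution. Replacing each letter \<open>i\<close> by
  \<open>k + 1 - i\<close> turns reverse alternating words into alternating ones.
\<close>

section \<open>Power sum expansions\<close>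

abbreviation (input) "mexp \<equiv> Poly_Mapping.lookup"

section \<open>Degrees of monomials and induction over them\<close>

lemma mdegree_superset: "finite S \<Longrightarrow> Poly_Mapping.keys m \<subseteq> S \<Longrightarrow> mdegree m = (\<Sum>i\<in>S. mexp m i)"
  unfolding mdegree_def by (rule sum.mono_neutral_left) (auto simp: in_keys_iff)

lemma mdegree_add: "mdegree (a + b) = mdegree a + mdegree b"
proof -
  let ?S = "Poly_Mapping.keys a \<union> Poly_Mapping.keys b"
  have "mdegree (a + b) = (\<Sum>i\<in>?S. mexp (a + b) i)"
    using Poly_Mapping.keys_add[of a b] by (intro mdegree_superset) auto
  then show ?thesis
    by (simp add: lookup_add sum.distrib mdegree_superset[of ?S])
qed

lemma mdegree_single [simp]: "mdegree (Poly_Mapping.single i r) = r"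
  by (simp add: mdegree_def)

lemma mdegree_0 [simp]: "mdegree 0 = 0"
  by (simp add: mdegree_def)

lemma lookup_le_mdegree: "mexp m i \<le> mdegree m"
  by (cases "i \<in> Poly_Mapping.keys m")
    (auto simp: mdegree_def in_keys_iff intro: member_le_sum)

lemma add_diff_single: "r \<le> mexp m i \<Longrightarrow> Poly_Mapping.single i r + (m - Poly_Mapping.single i r) = m"
  for r :: nat
  by (rule poly_mapping_eqI) (auto simp: lookup_add lookup_minus lookup_single when_def)

lemma mdegree_diff_single: "r \<le> mexp m i \<Longrightarrow> mdegree (m - Poly_Mapping.single i r) = mdegree m - r"
  using add_diff_single[of r m i] mdegree_add[of "Poly_Mapping.single i r" "m - Poly_Mapping.single i r"]
  by simp

text \<open>Meant for \<nu> as the exponent vector of a product of power sums: the step multiplies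
  by one more \<open>p\<^sub>i\<close>, and the index 0 never arises.\<close>

lemma monomial_induct [consumes 1, case_names zero add]:
  fixes \<nu> :: "nat \<Rightarrow>\<^sub>0 nat"
  assumes "0 \<notin> Poly_Mapping.keys \<nu>" and "P 0"
    and step: "\<And>\<nu> i. 0 \<notin> Poly_Mapping.keys \<nu> \<Longrightarrow> i \<ge> 1 \<Longrightarrow> P \<nu> \<Longrightarrow> P (\<nu> + Poly_Mapping.single i 1)"
  shows "P \<nu>"
  using assms(1)
proof (induction "mdegree \<nu>" arbitrary: \<nu> rule: less_induct)
  case less
  show ?case
  proof (cases "Poly_Mapping.keys \<nu> = {}")
    case True
    then have "\<nu> = 0" by simp
    then show ?thesis using assms(2) by simp
  next
    case False
    then obtain i where i: "i \<in> Poly_Mapping.keys \<nu>" by blast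
    define \<mu> where "\<mu> = \<nu> - Poly_Mapping.single i 1"
    have ge: "1 \<le> mexp \<nu> i" using i by (simp add: in_keys_iff Suc_le_eq)
    have \<nu>: "\<nu> = \<mu> + Poly_Mapping.single i 1"
      using add_diff_single[OF ge] by (simp add: \<mu>_def add.commute)
    have "0 \<notin> Poly_Mapping.keys \<mu>"
      using less.prems by (auto simp: in_keys_iff \<mu>_def lookup_minus)
    moreover have "mdegree \<mu> < mdegree \<nu>"
      by (simp add: \<nu> mdegree_add)
    moreover have "i \<ge> 1" using i less.prems by (cases i) auto
    ultimately have "P (\<mu> + Poly_Mapping.single i 1)"
      using less.hyps by (intro step) auto
    then show ?thesis by (simp only: \<nu>)
  qed
qed

section \<open>Coefficients of products and Newton's identities\<close>

lemma xseries_eqI: "(\<And>m. xcoeff f m = xcoeff g m) \<Longrightarrow> f = g"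
  by (simp add: xcoeff_inject[symmetric] fun_eq_iff)

lemma xcoeff_sum: "xcoeff (sum f S) m = (\<Sum>i\<in>S. xcoeff (f i) m)"
  by (induction S rule: infinite_finite_induct) (auto simp: zero_xseries.rep_eq plus_xseries.rep_eq)

lemma xcoeff_const_mult: "xcoeff (xconst c * f) m = c * xcoeff f m"
proof -
  have "(\<Sum>(a, b)\<in>splits m. xcoeff (xconst c) a * xcoeff f b) =
      (\<Sum>(a, b)\<in>{(0, m)}. xcoeff (xconst c) a * xcoeff f b)"
    by (rule sum.mono_neutral_right, simp) (auto simp: splits_def xconst.rep_eq split: if_splits)
  then show ?thesis by (simp add: times_xseries.rep_eq xconst.rep_eq)
qed

text \<open>The factor \<open>p\<^sub>r\<close> contributes the r-th power of one variable, which
  must divide m. For r \<ge> 1 different variables give different splittings of m, so nothing is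
  counted twice.\<close>

lemma xcoeff_sym_p_mult:
  assumes "r \<ge> 1"
  shows "xcoeff (sym_p r * f) m =
    (\<Sum>i\<in>Poly_Mapping.keys m. if r \<le> mexp m i then xcoeff f (m - Poly_Mapping.single i r) else 0)"
proof -
  let ?K = "{i \<in> Poly_Mapping.keys m. r \<le> mexp m i}"
  let ?g = "\<lambda>i. (Poly_Mapping.single i r, m - Poly_Mapping.single i r)"
  have inj: "inj_on ?g ?K"
  proof (rule inj_onI)
    fix i j assume "?g i = ?g j"
    then have "mexp (Poly_Mapping.single i r) i = mexp (Poly_Mapping.single j r) i" by simp
    then show "i = j" using assms by (auto simp: lookup_single when_def split: if_splits)
  qed
  have "xcoeff (sym_p r * f) m = (\<Sum>(a, b)\<in>splits m. xcoeff (sym_p r) a * xcoeff f b)"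
    by (simp add: times_xseries.rep_eq)
  also have "\<dots> = (\<Sum>(a, b)\<in>?g ` ?K. xcoeff (sym_p r) a * xcoeff f b)"
  proof (rule sum.mono_neutral_right)
    show "?g ` ?K \<subseteq> splits m" by (auto simp: splits_def add_diff_single)
    show "\<forall>p\<in>splits m - ?g ` ?K. (case p of (a, b) \<Rightarrow> xcoeff (sym_p r) a * xcoeff f b) = 0"
    proof (clarsimp simp: sym_p.rep_eq)
      fix b i
      assume s: "(Poly_Mapping.single i r, b) \<in> splits m" and n: "(Poly_Mapping.single i r, b) \<notin> ?g ` ?K"
      have m: "m = Poly_Mapping.single i r + b" using s by (simp add: splits_def)
      have "i \<in> ?K" using assms by (simp add: m in_keys_iff lookup_add)
      moreover have "b = m - Poly_Mapping.single i r" by (simp add: m)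
      ultimately have False using n by blast
      then show "xcoeff f b = 0" ..
    qed
  qed simp
  also have "\<dots> = (\<Sum>i\<in>?K. xcoeff f (m - Poly_Mapping.single i r))"
    by (subst sum.reindex[OF inj]) (auto simp: sym_p.rep_eq intro!: sum.cong)
  also have "\<dots> = (\<Sum>i\<in>Poly_Mapping.keys m. if r \<le> mexp m i then xcoeff f (m - Poly_Mapping.single i r) else 0)"
    by (simp add: sum.inter_filter)
  finally show ?thesis .
qed

lemma newton_sym_h:
  "xconst (of_nat n) * sym_h n = (\<Sum>r=1..n. sym_p r * sym_h (n - r))"
proof (rule xseries_eqI)
  fix m
  have "xcoeff (\<Sum>r=1..n. sym_p r * sym_h (n - r)) m =
      (\<Sum>r=1..n. \<Sum>i\<in>Poly_Mapping.keys m. if r \<le> mexp m i \<and> mdegree m = n then 1 else 0)"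
    unfolding xcoeff_sum
  proof (intro sum.cong refl)
    fix r assume r: "r \<in> {1..n}"
    have "(if r \<le> mexp m i then xcoeff (sym_h (n - r)) (m - Poly_Mapping.single i r) else 0) =
        (if r \<le> mexp m i \<and> mdegree m = n then 1 else 0)" for i
      using r lookup_le_mdegree[of m i] by (auto simp: sym_h.rep_eq mdegree_diff_single)
    then show "xcoeff (sym_p r * sym_h (n - r)) m =
        (\<Sum>i\<in>Poly_Mapping.keys m. if r \<le> mexp m i \<and> mdegree m = n then 1 else 0)"
      using r by (simp add: xcoeff_sym_p_mult)
  qed
  also have "\<dots> = (\<Sum>i\<in>Poly_Mapping.keys m. \<Sum>r=1..n. if r \<le> mexp m i \<and> mdegree m = n then 1 else 0)"
    by (rule sum.swap)
  also have "\<dots> = (if mdegree m = n then \<Sum>i\<in>Poly_Mapping.keys m. of_nat (mexp m i) else 0)"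
  proof (cases "mdegree m = n")
    case True
    have "(\<Sum>r=1..n. if r \<le> mexp m i then 1 else 0 :: rat) = of_nat (mexp m i)" for i
    proof -
      have "{r \<in> {1..n}. r \<le> mexp m i} = {1..mexp m i}"
        using lookup_le_mdegree[of m i] True by auto
      then show ?thesis by (simp flip: sum.inter_filter)
    qed
    then show ?thesis using True by simp
  qed simp
  also have "\<dots> = xcoeff (xconst (of_nat n) * sym_h n) m"
    by (auto simp: xcoeff_const_mult sym_h.rep_eq mdegree_def)
  finally show "xcoeff (xconst (of_nat n) * sym_h n) m = xcoeff (\<Sum>r=1..n. sym_p r * sym_h (n - r)) m"
    by simp
qed

text \<open>
  In \<open>p\<^sub>r e\<^bsub>n-r\<^esub>\<close> the squarefree part either contains the variable of \<open>p\<^sub>r\<close> or not, so the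
  coefficients are sums of two consecutive terms of the sequence counted here, and the alternating
  sum telescopes.
\<close>

definition near_squarefree :: "(nat \<Rightarrow>\<^sub>0 nat) \<Rightarrow> nat \<Rightarrow> nat set" where
  "near_squarefree m r = {i \<in> Poly_Mapping.keys m. mexp m i = r \<and> (\<forall>j. j \<noteq> i \<longrightarrow> mexp m j \<le> 1)}"

lemma xcoeff_sym_p_mult_sym_e:
  assumes "r \<in> {1..n}"
  shows "xcoeff (sym_p r * sym_e (n - r)) m =
    (if mdegree m = n then of_nat (card (near_squarefree m r)) + of_nat (card (near_squarefree m (Suc r))) else 0)"
proof -
  have "(if r \<le> mexp m i then xcoeff (sym_e (n - r)) (m - Poly_Mapping.single i r) else 0) =
      (if mdegree m = n \<and> i \<in> near_squarefree m r \<union> near_squarefree m (Suc r) then 1 else 0)"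
    if i: "i \<in> Poly_Mapping.keys m" for i
  proof (cases "r \<le> mexp m i")
    case True
    have "mdegree m - r = n - r \<longleftrightarrow> mdegree m = n"
      using True assms lookup_le_mdegree[of m i] by auto
    moreover have "(\<forall>j. mexp (m - Poly_Mapping.single i r) j \<le> 1) \<longleftrightarrow>
        i \<in> near_squarefree m r \<union> near_squarefree m (Suc r)"
    proof -
      have "mexp (m - Poly_Mapping.single i r) j = (if j = i then mexp m i - r else mexp m j)" for j
        by (simp add: lookup_minus lookup_single when_def)
      then have "(\<forall>j. mexp (m - Poly_Mapping.single i r) j \<le> 1) \<longleftrightarrow>
          mexp m i - r \<le> 1 \<and> (\<forall>j. j \<noteq> i \<longrightarrow> mexp m j \<le> 1)" by metis
      moreover have "mexp m i - r \<le> 1 \<longleftrightarrow> mexp m i = r \<or> mexp m i = Suc r"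
        using True by auto
      ultimately show ?thesis using i by (simp add: near_squarefree_def) blast
    qed
    ultimately show ?thesis
      using True by (simp add: sym_e.rep_eq mdegree_diff_single)
  next
    case False
    then show ?thesis by (auto simp: near_squarefree_def)
  qed
  then have "xcoeff (sym_p r * sym_e (n - r)) m = (\<Sum>i\<in>Poly_Mapping.keys m.
      if mdegree m = n \<and> i \<in> near_squarefree m r \<union> near_squarefree m (Suc r) then 1 else 0)"
    using assms by (simp add: xcoeff_sym_p_mult)
  also have "\<dots> = (if mdegree m = n then of_nat (card (near_squarefree m r \<union> near_squarefree m (Suc r))) else 0)"
  proof -
    have "{i \<in> Poly_Mapping.keys m. i \<in> near_squarefree m r \<union> near_squarefree m (Suc r)} =
        near_squarefree m r \<union> near_squarefree m (Suc r)"
      by (auto simp: near_squarefree_def)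
    then show ?thesis by (simp flip: sum.inter_filter)
  qed
  also have "card (near_squarefree m r \<union> near_squarefree m (Suc r)) =
      card (near_squarefree m r) + card (near_squarefree m (Suc r))"
    by (rule card_Un_disjoint) (auto simp: near_squarefree_def)
  finally show ?thesis by simp
qed

lemma telescope_alternating:
  fixes q :: "nat \<Rightarrow> 'a::comm_ring_1"
  shows "(\<Sum>r=1..n. (-1) ^ (r - 1) * (q r + q (Suc r))) = q 1 - (-1) ^ n * q (Suc n)"
  by (induction n) (auto simp: algebra_simps)

lemma newton_sym_e:
  "xconst (of_nat n) * sym_e n = (\<Sum>r=1..n. xconst ((-1) ^ (r - 1)) * (sym_p r * sym_e (n - r)))"
proof (rule xseries_eqI)
  fix m
  let ?q = "\<lambda>r. of_nat (card (near_squarefree m r)) :: rat"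
  have "xcoeff (\<Sum>r=1..n. xconst ((-1) ^ (r - 1)) * (sym_p r * sym_e (n - r))) m =
      (\<Sum>r=1..n. (-1) ^ (r - 1) * (if mdegree m = n then ?q r + ?q (Suc r) else 0))"
    by (simp add: xcoeff_sum xcoeff_const_mult xcoeff_sym_p_mult_sym_e)
  also have "\<dots> = (if mdegree m = n then ?q 1 - (-1) ^ n * ?q (Suc n) else 0)"
    using telescope_alternating[of ?q n] by simp
  also have "\<dots> = xcoeff (xconst (of_nat n) * sym_e n) m"
  proof (cases "mdegree m = n")
    case True
    \<comment> \<open>No exponent exceeds the degree n, so the far end of the telescoped sum
      vanishes. The near end counts the variables of a squarefree monomial of degree n, of which
      there are n, and is 0 for any other monomial.\<close>
    have "near_squarefree m (Suc n) = {}"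
      using lookup_le_mdegree[of m] True by (auto simp: near_squarefree_def) (metis Suc_n_not_le_n)
    moreover have "card (near_squarefree m 1) = (if \<forall>i. mexp m i \<le> 1 then n else 0)"
    proof (cases "\<forall>i. mexp m i \<le> 1")
      case sqf: True
      then have one: "mexp m i = 1" if "i \<in> Poly_Mapping.keys m" for i
        using that by (metis in_keys_iff le_antisym less_one not_le)
      have "near_squarefree m 1 = Poly_Mapping.keys m"
        using sqf one by (auto simp: near_squarefree_def)
      moreover have "card (Poly_Mapping.keys m) = n"
        using True one by (simp add: mdegree_def)
      ultimately show ?thesis using sqf by simp
    next
      case False
      have "near_squarefree m 1 = {}"
      proof (rule ccontr)
        assume "near_squarefree m 1 \<noteq> {}"
        then obtain i where "mexp m i = 1" "\<forall>j. j \<noteq> i \<longrightarrow> mexp m j \<le> 1"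
          by (auto simp: near_squarefree_def)
        then have "\<forall>j. mexp m j \<le> 1" by (metis order_refl)
        then show False using False by simp
      qed
      then show ?thesis using False by auto
    qed
    ultimately show ?thesis using True by (simp add: xcoeff_const_mult sym_e.rep_eq)
  qed (simp add: xcoeff_const_mult sym_e.rep_eq)
  finally show "xcoeff (xconst (of_nat n) * sym_e n) m =
      xcoeff (\<Sum>r=1..n. xconst ((-1) ^ (r - 1)) * (sym_p r * sym_e (n - r))) m" by simp
qed

section \<open>Evaluation of polynomials is a ring homomorphism\<close>

definition eval_monom :: "(nat \<Rightarrow> 'a::comm_ring_1) \<Rightarrow> (nat \<Rightarrow>\<^sub>0 nat) \<Rightarrow> 'a" where
  "eval_monom v m = (\<Prod>i\<in>Poly_Mapping.keys m. v i ^ mexp m i)"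

lemma eval_monom_superset:
  "finite S \<Longrightarrow> Poly_Mapping.keys m \<subseteq> S \<Longrightarrow> eval_monom v m = (\<Prod>i\<in>S. v i ^ mexp m i)"
  unfolding eval_monom_def by (rule prod.mono_neutral_left) (auto simp: in_keys_iff)

lemma eval_monom_add: "eval_monom v (a + b) = eval_monom v a * eval_monom v b"
proof -
  let ?S = "Poly_Mapping.keys a \<union> Poly_Mapping.keys b"
  have "eval_monom v (a + b) = (\<Prod>i\<in>?S. v i ^ mexp (a + b) i)"
    using Poly_Mapping.keys_add[of a b] by (intro eval_monom_superset) auto
  then show ?thesis
    by (simp add: lookup_add power_add prod.distrib eval_monom_superset[of ?S])
qed

lemma eval_monom_0 [simp]: "eval_monom v 0 = 1"
  by (simp add: eval_monom_def)

lemma eval_monom_single [simp]: "eval_monom v (Poly_Mapping.single i r) = v i ^ r"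
  by (simp add: eval_monom_def)

lemma poly_mapping_sum_single:
  fixes P :: "'b \<Rightarrow>\<^sub>0 'c::comm_monoid_add"
  shows "P = (\<Sum>m\<in>Poly_Mapping.keys P. Poly_Mapping.single m (Poly_Mapping.lookup P m))"
  by (rule poly_mapping_eqI)
    (auto simp: lookup_sum lookup_single when_def sum.delta in_keys_iff)

text \<open>The embedding of the coefficients stays abstract because two are needed: into the
  series, to state expansions, and into the polynomials in E, to substitute.\<close>

locale rat_hom =
  fixes c :: "rat \<Rightarrow> 'a::comm_ring_1"
  assumes hom_0 [simp]: "c 0 = 0" and hom_1 [simp]: "c 1 = 1"
    and hom_add: "c (x + y) = c x + c y" and hom_mult: "c (x * y) = c x * c y"
begin

lemma eval_superset:
  assumes "finite S" "Poly_Mapping.keys P \<subseteq> S"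
  shows "eval_mpoly c v P = (\<Sum>m\<in>S. c (Poly_Mapping.lookup P m) * eval_monom v m)"
  unfolding eval_mpoly_def eval_monom_def
  by (rule sum.mono_neutral_left) (use assms in \<open>auto simp: in_keys_iff\<close>)

lemma eval_add: "eval_mpoly c v (P + Q) = eval_mpoly c v P + eval_mpoly c v Q"
proof -
  let ?S = "Poly_Mapping.keys P \<union> Poly_Mapping.keys Q"
  have "eval_mpoly c v (P + Q) = (\<Sum>m\<in>?S. c (Poly_Mapping.lookup (P + Q) m) * eval_monom v m)"
    using Poly_Mapping.keys_add[of P Q] by (intro eval_superset) auto
  then show ?thesis
    by (simp add: lookup_add hom_add distrib_right sum.distrib eval_superset[of ?S])
qed

lemma eval_0 [simp]: "eval_mpoly c v 0 = 0"
  by (simp add: eval_mpoly_def)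

lemma eval_sum: "eval_mpoly c v (sum f S) = (\<Sum>i\<in>S. eval_mpoly c v (f i))"
  by (induction S rule: infinite_finite_induct) (auto simp: eval_add)

lemma eval_single: "eval_mpoly c v (Poly_Mapping.single m q) = c q * eval_monom v m"
  by (subst eval_superset[of "{m}"]) auto

lemma eval_mult: "eval_mpoly c v (P * Q) = eval_mpoly c v P * eval_mpoly c v Q"
proof -
  have "P * Q = (\<Sum>a\<in>Poly_Mapping.keys P. \<Sum>b\<in>Poly_Mapping.keys Q.
      Poly_Mapping.single (a + b) (Poly_Mapping.lookup P a * Poly_Mapping.lookup Q b))"
    by (subst (1) poly_mapping_sum_single[of P], subst (1) poly_mapping_sum_single[of Q])
      (simp add: sum_product mult_single)
  then have "eval_mpoly c v (P * Q) = (\<Sum>a\<in>Poly_Mapping.keys P. \<Sum>b\<in>Poly_Mapping.keys Q.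
      (c (Poly_Mapping.lookup P a) * eval_monom v a) * (c (Poly_Mapping.lookup Q b) * eval_monom v b))"
    by (simp add: eval_sum eval_single hom_mult eval_monom_add mult_ac)
  also have "\<dots> = eval_mpoly c v P * eval_mpoly c v Q"
    by (simp add: sum_product eval_superset[OF finite_keys order_refl])
  finally show ?thesis .
qed

end

interpretation xconst: rat_hom xconst
proof
  show "xconst 0 = 0" by (rule xseries_eqI) (simp add: xconst.rep_eq zero_xseries.rep_eq)
  show "xconst 1 = 1" by (rule xseries_eqI) (simp add: xconst.rep_eq one_xseries.rep_eq)
  show "xconst (x + y) = xconst x + xconst y" for x y
    by (rule xseries_eqI) (simp add: xconst.rep_eq plus_xseries.rep_eq)
  show "xconst (x * y) = xconst x * xconst y" for x y
    by (rule xseries_eqI) (simp add: xcoeff_const_mult, simp add: xconst.rep_eq)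
qed

interpretation pconst: rat_hom "\<lambda>q. [:q:]"
  by standard (auto simp: one_pCons)

section \<open>Algebraic independence of the power sums\<close>

text \<open>The partition formed by the exponents of m, in multiplicity notation: the entry at r
  counts the variables of exponent r. As an exponent vector it also names a product of power
  sums.\<close>

definition shape :: "(nat \<Rightarrow>\<^sub>0 nat) \<Rightarrow> (nat \<Rightarrow>\<^sub>0 nat)" where
  "shape m = (\<Sum>j\<in>Poly_Mapping.keys m. Poly_Mapping.single (mexp m j) 1)"

lemma mdegree_sum: "mdegree (sum f S) = (\<Sum>i\<in>S. mdegree (f i))"
  by (induction S rule: infinite_finite_induct) (auto simp: mdegree_add)

lemma mdegree_shape: "mdegree (shape m) = card (Poly_Mapping.keys m)"
  by (simp add: shape_def mdegree_sum)

lemma shape_add_single: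
  assumes "j \<notin> Poly_Mapping.keys m" "i \<ge> 1"
  shows "shape (m + Poly_Mapping.single j i) = shape m + Poly_Mapping.single i 1"
proof -
  let ?n = "m + Poly_Mapping.single j i"
  have l: "mexp ?n x = (if x = j then i else mexp m x)" for x
    using assms(1) by (auto simp: lookup_add lookup_single when_def in_keys_iff)
  have "Poly_Mapping.keys ?n = insert j (Poly_Mapping.keys m)"
    using assms(2) by (auto simp: in_keys_iff l split: if_splits)
  then have "shape ?n = Poly_Mapping.single i 1 +
      (\<Sum>x\<in>Poly_Mapping.keys m. Poly_Mapping.single (mexp ?n x) 1)"
    using assms(1) by (simp add: shape_def l)
  also have "(\<Sum>x\<in>Poly_Mapping.keys m. Poly_Mapping.single (mexp ?n x) 1) = shape m"
    unfolding shape_def using assms(1) by (intro sum.cong refl) (auto simp: l)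
  finally show ?thesis by (simp add: add.commute)
qed

text \<open>Each part i receives a fresh variable raised to the power i.\<close>

lemma ex_shape: "0 \<notin> Poly_Mapping.keys \<nu> \<Longrightarrow> \<exists>m. shape m = \<nu>"
proof (induction \<nu> rule: monomial_induct)
  case zero
  then show ?case by (intro exI[of _ 0]) (simp add: shape_def)
next
  case (add \<nu> i)
  then obtain m where "shape m = \<nu>" by auto
  moreover obtain j where "j \<notin> Poly_Mapping.keys m"
    using ex_new_if_finite[OF infinite_UNIV_nat finite_keys] by blast
  ultimately show ?case
    using add(2) by (intro exI[of _ "m + Poly_Mapping.single j i"]) (simp add: shape_add_single)
qed

lemma eval_monom_add_single:
  "eval_monom sym_p (\<nu> + Poly_Mapping.single i 1) = sym_p i * eval_monom sym_p \<nu>"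
  by (simp add: eval_monom_add mult.commute)

text \<open>Rules out cancellation, so that in \<open>xcoeff_power_sum_shape\<close> a single
  positive summand bounds the coefficient from below.\<close>

lemma xcoeff_power_sum_nonneg:
  "0 \<notin> Poly_Mapping.keys \<nu> \<Longrightarrow> xcoeff (eval_monom sym_p \<nu>) m \<ge> 0"
proof (induction \<nu> arbitrary: m rule: monomial_induct)
  case (add \<nu> i)
  then show ?case
    unfolding eval_monom_add_single by (subst xcoeff_sym_p_mult) (auto intro!: sum_nonneg)
qed (simp add: one_xseries.rep_eq)

lemma xcoeff_power_sum_shape:
  "0 \<notin> Poly_Mapping.keys \<nu> \<Longrightarrow> shape m = \<nu> \<Longrightarrow> xcoeff (eval_monom sym_p \<nu>) m > 0"
proof (induction \<nu> arbitrary: m rule: monomial_induct)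
  case zero
  then have "card (Poly_Mapping.keys m) = 0" using mdegree_shape[of m] by simp
  then have "m = 0" by simp
  then show ?case by (simp add: one_xseries.rep_eq)
next
  case (add \<nu> i)
  have "\<exists>j\<in>Poly_Mapping.keys m. mexp m j = i"
  proof (rule ccontr)
    assume "\<not> ?thesis"
    then have "mexp (shape m) i = 0"
      by (auto simp: shape_def lookup_sum lookup_single when_def)
    then show False using add.prems by (simp add: lookup_add)
  qed
  then obtain j where j: "j \<in> Poly_Mapping.keys m" "mexp m j = i" by auto
  define m' where "m' = m - Poly_Mapping.single j i"
  have m: "m = m' + Poly_Mapping.single j i"
    using add_diff_single[of i m j] j by (simp add: m'_def add.commute)
  have "j \<notin> Poly_Mapping.keys m'" using j by (simp add: m'_def in_keys_iff lookup_minus)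
  then have "shape m' = \<nu>" using shape_add_single[of j m' i] add m by simp
  then have "0 < xcoeff (eval_monom sym_p \<nu>) m'" using add.IH by simp
  also have "\<dots> \<le> xcoeff (sym_p i * eval_monom sym_p \<nu>) m"
    unfolding xcoeff_sym_p_mult[OF add(2)]
    using member_le_sum[of j "Poly_Mapping.keys m"
        "\<lambda>j. if i \<le> mexp m j then xcoeff (eval_monom sym_p \<nu>) (m - Poly_Mapping.single j i) else 0"]
      j xcoeff_power_sum_nonneg[OF add(1)] by (simp add: m'_def)
  finally show ?case unfolding eval_monom_add_single .
qed

text \<open>Every factor contributes a power of one variable and so raises the number of variables
  by at most one. Equality means that each factor brought a fresh variable, whose exponent is then
  the index of that factor.\<close>

lemma xcoeff_power_sum_nonzero:
  "0 \<notin> Poly_Mapping.keys \<nu> \<Longrightarrow> xcoeff (eval_monom sym_p \<nu>) m \<noteq> 0 \<Longrightarrow>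
     card (Poly_Mapping.keys m) \<le> mdegree \<nu> \<and> (card (Poly_Mapping.keys m) = mdegree \<nu> \<longrightarrow> shape m = \<nu>)"
proof (induction \<nu> arbitrary: m rule: monomial_induct)
  case zero
  then have "m = 0" by (simp add: one_xseries.rep_eq split: if_splits)
  then show ?case by (simp add: shape_def)
next
  case (add \<nu> i)
  from add.prems obtain j where j: "i \<le> mexp m j"
      "xcoeff (eval_monom sym_p \<nu>) (m - Poly_Mapping.single j i) \<noteq> 0"
    unfolding eval_monom_add_single xcoeff_sym_p_mult[OF add(2)]
    by (auto elim!: sum.not_neutral_contains_not_neutral split: if_splits)
  define m' where "m' = m - Poly_Mapping.single j i"
  have m: "m = m' + Poly_Mapping.single j i"
    using add_diff_single[of i m j] j by (simp add: m'_def add.commute)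
  have IH: "card (Poly_Mapping.keys m') \<le> mdegree \<nu>"
      "card (Poly_Mapping.keys m') = mdegree \<nu> \<Longrightarrow> shape m' = \<nu>"
    using add.IH[OF j(2)] by (auto simp: m'_def)
  have keys: "Poly_Mapping.keys m = insert j (Poly_Mapping.keys m')"
    using add(2) by (auto simp: m in_keys_iff lookup_add lookup_single when_def split: if_splits)
  show ?case
  proof (cases "j \<in> Poly_Mapping.keys m'")
    case True
    then have "Poly_Mapping.keys m = Poly_Mapping.keys m'" using keys by auto
    then show ?thesis using IH by (simp add: mdegree_add)
  next
    case False
    then have "card (Poly_Mapping.keys m) = Suc (card (Poly_Mapping.keys m'))"
      by (simp add: keys)
    then show ?thesis
      using IH shape_add_single[OF False add(2)] by (auto simp: mdegree_add m)
  qed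
qed

text \<open>
  Multiplying out a product of power sums can only merge its parts, so the monomial \<open>x\<^sup>\<nu>\<close> with
  pairwise distinct variables occurs in no product with as few factors as \<open>p\<^sub>\<nu>\<close> except \<open>p\<^sub>\<nu>\<close> itself.
\<close>

lemma power_sums_independent:
  assumes no0: "\<forall>m\<in>Poly_Mapping.keys P. 0 \<notin> Poly_Mapping.keys m"
    and "eval_mpoly xconst sym_p P = 0"
  shows "P = 0"
proof (rule ccontr)
  assume "P \<noteq> 0"
  then have "Poly_Mapping.keys P \<noteq> {}" by simp
  \<comment> \<open>A monomial of maximal degree is selected: every other product in P then has at
    most as many factors.\<close>
  then have "Max (mdegree ` Poly_Mapping.keys P) \<in> mdegree ` Poly_Mapping.keys P" by simp
  then obtain \<nu> where \<nu>: "\<nu> \<in> Poly_Mapping.keys P" "mdegree \<nu> = Max (mdegree ` Poly_Mapping.keys P)"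
    by auto
  have max: "mdegree \<mu> \<le> mdegree \<nu>" if "\<mu> \<in> Poly_Mapping.keys P" for \<mu>
    using that \<nu>(2) by simp
  have \<nu>0: "0 \<notin> Poly_Mapping.keys \<nu>" using no0 \<nu>(1) by auto
  then obtain m where m: "shape m = \<nu>" using ex_shape by auto
  have card: "card (Poly_Mapping.keys m) = mdegree \<nu>" using mdegree_shape[of m] m by simp
  have zero: "xcoeff (eval_monom sym_p \<mu>) m = 0" if "\<mu> \<in> Poly_Mapping.keys P" "\<mu> \<noteq> \<nu>" for \<mu>
  proof (rule ccontr)
    assume "xcoeff (eval_monom sym_p \<mu>) m \<noteq> 0"
    with xcoeff_power_sum_nonzero[of \<mu> m] that(1) no0 card max[OF that(1)] m have "\<mu> = \<nu>" by auto
    then show False using that(2) by simp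
  qed
  have "0 = xcoeff (eval_mpoly xconst sym_p P) m"
    using assms(2) by (simp add: zero_xseries.rep_eq)
  also have "\<dots> = (\<Sum>\<mu>\<in>Poly_Mapping.keys P. Poly_Mapping.lookup P \<mu> * xcoeff (eval_monom sym_p \<mu>) m)"
    by (simp add: xconst.eval_superset[OF finite_keys order_refl] xcoeff_sum xcoeff_const_mult)
  also have "\<dots> = (\<Sum>\<mu>\<in>{\<nu>}. Poly_Mapping.lookup P \<mu> * xcoeff (eval_monom sym_p \<mu>) m)"
    using \<nu>(1) zero by (intro sum.mono_neutral_right) auto
  finally show False
    using xcoeff_power_sum_shape[OF \<nu>0 m] \<nu>(1) by (simp add: in_keys_iff)
qed

section \<open>The substitution as a ring homomorphism\<close>

lemma power_sum_expansion_unique: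
  assumes "power_sum_expansion f P" "power_sum_expansion f Q"
  shows "P = Q"
proof -
  have "eval_mpoly xconst sym_p ((P - Q) + Q) = eval_mpoly xconst sym_p (P - Q) + eval_mpoly xconst sym_p Q"
    by (rule xconst.eval_add)
  then have "eval_mpoly xconst sym_p (P - Q) = 0"
    using assms by (simp add: power_sum_expansion_def)
  moreover have "\<forall>m\<in>Poly_Mapping.keys (P - Q). 0 \<notin> Poly_Mapping.keys m"
    using assms keys_diff[of P Q] by (auto simp: power_sum_expansion_def)
  ultimately have "P - Q = 0" by (intro power_sums_independent)
  then show ?thesis by simp
qed

lemma psubst_eq: "power_sum_expansion f P \<Longrightarrow> psubst f a = eval_mpoly (\<lambda>q. [:q:]) a P"
  unfolding psubst_def
  by (rule arg_cong[where f = "eval_mpoly (\<lambda>q. [:q:]) a"])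
    (rule the_equality, auto intro: power_sum_expansion_unique)

lemma power_sum_expansion_mult:
  assumes "power_sum_expansion f P" "power_sum_expansion g Q"
  shows "power_sum_expansion (f * g) (P * Q)"
proof -
  have "0 \<notin> Poly_Mapping.keys m" if m: "m \<in> Poly_Mapping.keys (P * Q)" for m
  proof -
    obtain a b where "m = a + b" "a \<in> Poly_Mapping.keys P" "b \<in> Poly_Mapping.keys Q"
      using m keys_mult[of P Q] by blast
    then show ?thesis
      using assms Poly_Mapping.keys_add[of a b] by (auto simp: power_sum_expansion_def)
  qed
  then show ?thesis
    using assms by (auto simp: power_sum_expansion_def xconst.eval_mult)
qed

lemma power_sum_expansion_add:
  assumes "power_sum_expansion f P" "power_sum_expansion g Q"
  shows "power_sum_expansion (f + g) (P + Q)"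
  using assms Poly_Mapping.keys_add[of P Q]
  by (auto simp: power_sum_expansion_def xconst.eval_add)

lemma power_sum_expansion_xconst: "power_sum_expansion (xconst q) (Poly_Mapping.single 0 q)"
  by (auto simp: power_sum_expansion_def xconst.eval_single)

lemma power_sum_expansion_sym_p:
  "r \<ge> 1 \<Longrightarrow> power_sum_expansion (sym_p r) (Poly_Mapping.single (Poly_Mapping.single r 1) 1)"
  by (auto simp: power_sum_expansion_def xconst.eval_single)

text \<open>\<open>psubst\<close> selects the expansion by \<open>THE\<close>, so its algebraic laws
  are derived for series that have one.\<close>

definition has_expansion :: "xseries \<Rightarrow> bool" where
  "has_expansion f \<longleftrightarrow> (\<exists>P. power_sum_expansion f P)"

lemma has_expansion_mult: "has_expansion f \<Longrightarrow> has_expansion g \<Longrightarrow> has_expansion (f * g)"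
  unfolding has_expansion_def using power_sum_expansion_mult by blast

lemma has_expansion_add: "has_expansion f \<Longrightarrow> has_expansion g \<Longrightarrow> has_expansion (f + g)"
  unfolding has_expansion_def using power_sum_expansion_add by blast

lemma has_expansion_xconst: "has_expansion (xconst q)"
  unfolding has_expansion_def using power_sum_expansion_xconst by blast

lemma has_expansion_sym_p: "r \<ge> 1 \<Longrightarrow> has_expansion (sym_p r)"
  unfolding has_expansion_def using power_sum_expansion_sym_p by blast

lemma has_expansion_sum: "(\<And>i. i \<in> S \<Longrightarrow> has_expansion (f i)) \<Longrightarrow> has_expansion (sum f S)"
  by (induction S rule: infinite_finite_induct)
    (use has_expansion_xconst[of 0] in \<open>auto intro: has_expansion_add\<close>)

lemma has_expansion_prod: "(\<And>i. i \<in> S \<Longrightarrow> has_expansion (f i)) \<Longrightarrow> has_expansion (prod f S)"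
  by (induction S rule: infinite_finite_induct)
    (use has_expansion_xconst[of 1] in \<open>auto intro: has_expansion_mult\<close>)

lemma psubst_mult: "has_expansion f \<Longrightarrow> has_expansion g \<Longrightarrow> psubst (f * g) a = psubst f a * psubst g a"
proof -
  assume "has_expansion f" "has_expansion g"
  then obtain P Q where P: "power_sum_expansion f P" and Q: "power_sum_expansion g Q"
    unfolding has_expansion_def by blast
  show ?thesis
    unfolding psubst_eq[OF P] psubst_eq[OF Q] psubst_eq[OF power_sum_expansion_mult[OF P Q]]
    by (rule pconst.eval_mult)
qed

lemma psubst_add: "has_expansion f \<Longrightarrow> has_expansion g \<Longrightarrow> psubst (f + g) a = psubst f a + psubst g a"
proof -
  assume "has_expansion f" "has_expansion g"
  then obtain P Q where P: "power_sum_expansion f P" and Q: "power_sum_expansion g Q"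
    unfolding has_expansion_def by blast
  show ?thesis
    unfolding psubst_eq[OF P] psubst_eq[OF Q] psubst_eq[OF power_sum_expansion_add[OF P Q]]
    by (rule pconst.eval_add)
qed

lemma psubst_xconst [simp]: "psubst (xconst q) a = [:q:]"
  by (simp add: psubst_eq[OF power_sum_expansion_xconst] pconst.eval_single)

lemma psubst_sym_p: "r \<ge> 1 \<Longrightarrow> psubst (sym_p r) a = a r"
  by (simp add: psubst_eq[OF power_sum_expansion_sym_p] pconst.eval_single flip: one_pCons)

lemma psubst_sum:
  "(\<And>i. i \<in> S \<Longrightarrow> has_expansion (f i)) \<Longrightarrow> psubst (sum f S) a = (\<Sum>i\<in>S. psubst (f i) a)"
  by (induction S rule: infinite_finite_induct)
    (use psubst_xconst[of 0] in \<open>auto simp: psubst_add has_expansion_sum\<close>)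

lemma psubst_prod:
  "(\<And>i. i \<in> S \<Longrightarrow> has_expansion (f i)) \<Longrightarrow> psubst (prod f S) a = (\<Prod>i\<in>S. psubst (f i) a)"
  by (induction S rule: infinite_finite_induct)
    (use psubst_xconst[of 1] in \<open>auto simp: psubst_mult has_expansion_prod simp flip: one_pCons\<close>)

text \<open>Dividing Newton's identity by n, possible over the rationals, writes \<open>f n\<close>
  through power sums and earlier members. The coefficients \<open>s\<close> let one argument serve
  both \<open>sym_e\<close> and \<open>sym_h\<close>.\<close>

lemma newton_has_expansion:
  assumes f0: "f 0 = 1"
    and newton: "\<And>n. xconst (of_nat n) * f n = (\<Sum>r=1..n. xconst (s r) * (sym_p r * f (n - r)))"
  shows "has_expansion (f n)"
proof (induction n rule: less_induct)
  case (less n)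
  show ?case
  proof (cases "n = 0")
    case True
    then show ?thesis using f0 has_expansion_xconst[of 1] by simp
  next
    case False
    have "f n = xconst (1 / of_nat n) * (xconst (of_nat n) * f n)"
      using False by (simp flip: mult.assoc xconst.hom_mult)
    moreover have "has_expansion (xconst (1 / of_nat n) * (xconst (of_nat n) * f n))"
      unfolding newton
      by (intro has_expansion_mult has_expansion_sum has_expansion_xconst has_expansion_sym_p less) auto
    ultimately show ?thesis by simp
  qed
qed

lemma psubst_newton:
  assumes f0: "f 0 = 1"
    and newton: "\<And>n. xconst (of_nat n) * f n = (\<Sum>r=1..n. xconst (s r) * (sym_p r * f (n - r)))"
  shows "of_nat n * psubst (f n) a = (\<Sum>r=1..n. [:s r:] * a r * psubst (f (n - r)) a)"
proof -
  note exp = newton_has_expansion[of f s, OF f0 newton]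
  have "of_nat n * psubst (f n) a = psubst (xconst (of_nat n) * f n) a"
    using exp by (simp add: psubst_mult has_expansion_xconst of_nat_poly)
  also have "\<dots> = (\<Sum>r=1..n. psubst (xconst (s r) * (sym_p r * f (n - r))) a)"
    unfolding newton
    by (intro psubst_sum has_expansion_mult has_expansion_xconst has_expansion_sym_p exp) auto
  also have "\<dots> = (\<Sum>r=1..n. [:s r:] * a r * psubst (f (n - r)) a)"
    using exp by (intro sum.cong refl)
      (simp add: psubst_mult has_expansion_mult has_expansion_xconst has_expansion_sym_p psubst_sym_p)
  finally show ?thesis .
qed

lemma mdegree_eq_0_iff: "mdegree m = 0 \<longleftrightarrow> m = 0"
  unfolding mdegree_def by (subst sum_eq_0_iff) (auto simp: in_keys_iff poly_mapping_eq_iff fun_eq_iff)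

lemma sym_h_0: "sym_h 0 = 1"
  by (rule xseries_eqI) (simp add: sym_h.rep_eq one_xseries.rep_eq mdegree_eq_0_iff)

lemma sym_e_0: "sym_e 0 = 1"
  by (rule xseries_eqI) (auto simp: sym_e.rep_eq one_xseries.rep_eq mdegree_eq_0_iff)

lemma newton_sym_h':
  "xconst (of_nat n) * sym_h n = (\<Sum>r=1..n. xconst 1 * (sym_p r * sym_h (n - r)))"
  by (simp add: newton_sym_h)

lemmas has_expansion_sym_e = newton_has_expansion[OF sym_e_0 newton_sym_e]
lemmas has_expansion_sym_h = newton_has_expansion[OF sym_h_0 newton_sym_h']
lemmas psubst_newton_sym_e = psubst_newton[OF sym_e_0 newton_sym_e]
lemmas psubst_newton_sym_h = psubst_newton[OF sym_h_0 newton_sym_h']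

section \<open>Transfer equations for alternating words\<close>

text \<open>
  A function of the exponents \<open>\<alpha>\<close> stands for a power series in variables \<open>t\<^sub>1, \<dots>, t\<^sub>k\<close>. Then
  \<open>shift_at j\<close> is multiplication by \<open>t\<^sub>j\<close>, \<open>rot_prod a\<close> is multiplication by the product of the
  \<open>1 + \<i> t\<^sub>j\<close> for \<open>j \<le> a\<close>, and \<open>norm_prod A a\<close> by the product of the \<open>1 + t\<^sub>j\<^sup>2\<close> for \<open>j \<in> A\<close>,
  \<open>j \<le> a\<close>.
\<close>

definition shift_at :: "nat \<Rightarrow> ((nat \<Rightarrow> nat) \<Rightarrow> complex) \<Rightarrow> (nat \<Rightarrow> nat) \<Rightarrow> complex" where
  "shift_at j F \<alpha> = (if \<alpha> j = 0 then 0 else F (\<alpha>(j := \<alpha> j - 1)))"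

primrec rot_prod :: "nat \<Rightarrow> ((nat \<Rightarrow> nat) \<Rightarrow> complex) \<Rightarrow> (nat \<Rightarrow> nat) \<Rightarrow> complex" where
  "rot_prod 0 F = F"
| "rot_prod (Suc a) F = (\<lambda>\<alpha>. rot_prod a F \<alpha> + \<i> * shift_at (Suc a) (rot_prod a F) \<alpha>)"

primrec norm_prod :: "nat set \<Rightarrow> nat \<Rightarrow> ((nat \<Rightarrow> nat) \<Rightarrow> complex) \<Rightarrow> (nat \<Rightarrow> nat) \<Rightarrow> complex" where
  "norm_prod A 0 F = F"
| "norm_prod A (Suc a) F =
     (if Suc a \<in> A
      then \<lambda>\<alpha>. norm_prod A a F \<alpha> + shift_at (Suc a) (shift_at (Suc a) (norm_prod A a F)) \<alpha>
      else norm_prod A a F)"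

section \<open>Product operators and uniqueness of solutions\<close>

lemma shift_at_lin: "shift_at j (\<lambda>\<alpha>. F \<alpha> + c * G \<alpha>) = (\<lambda>\<alpha>. shift_at j F \<alpha> + c * shift_at j G \<alpha>)"
  by (auto simp: shift_at_def fun_eq_iff)

lemma shift_at_commute: "shift_at j (shift_at l F) = shift_at l (shift_at j F)"
  by (cases "j = l") (auto simp: shift_at_def fun_eq_iff fun_upd_twist)

lemma rot_prod_lin:
  "rot_prod a (\<lambda>\<alpha>. F \<alpha> + c * G \<alpha>) = (\<lambda>\<alpha>. rot_prod a F \<alpha> + c * rot_prod a G \<alpha>)"
  by (induction a) (simp_all add: shift_at_lin algebra_simps)

lemma norm_prod_lin:
  "norm_prod A a (\<lambda>\<alpha>. F \<alpha> + c * G \<alpha>) = (\<lambda>\<alpha>. norm_prod A a F \<alpha> + c * norm_prod A a G \<alpha>)"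
  by (induction a) (simp_all add: shift_at_lin algebra_simps)

lemma shift_at_add: "shift_at j (\<lambda>\<alpha>. F \<alpha> + G \<alpha>) = (\<lambda>\<alpha>. shift_at j F \<alpha> + shift_at j G \<alpha>)"
  using shift_at_lin[of j F 1 G] by simp

lemma norm_prod_shift_at: "norm_prod A a (shift_at j F) = shift_at j (norm_prod A a F)"
proof (induction a)
  case (Suc a)
  then show ?case
    using shift_at_commute[of "Suc a" j] by (simp add: shift_at_add)
qed simp

text \<open>For a letter of A the relation determines \<open>z a\<close> from
  \<open>z (Suc a)\<close>, so going upwards would require the inverse of 1 - \<i> t. Multiplying by
  1 + t^2 for these letters avoids inverses and leaves a factor 1 + \<i> t for every letter.\<close>

lemma norm_prod_eq_rot_prod:
  assumes "\<And>a. a < k \<Longrightarrow> Suc a \<in> A \<Longrightarrow> z a = (\<lambda>\<alpha>. z (Suc a) \<alpha> + (- \<i>) * shift_at (Suc a) (z (Suc a)) \<alpha>)"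
    and "\<And>a. a < k \<Longrightarrow> Suc a \<notin> A \<Longrightarrow> z (Suc a) = (\<lambda>\<alpha>. z a \<alpha> + \<i> * shift_at (Suc a) (z a) \<alpha>)"
    and "a \<le> k"
  shows "norm_prod A a (z a) = rot_prod a (z 0)"
  using assms(3)
proof (induction a)
  case (Suc a)
  then have IH: "norm_prod A a (z a) = rot_prod a (z 0)" and a: "a < k" by auto
  show ?case
  proof (cases "Suc a \<in> A")
    case True
    \<comment> \<open>\<open>1 + t\<^sup>2 = (1 + \<i> t) (1 - \<i> t)\<close>\<close>
    let ?w = "norm_prod A a (z (Suc a))"
    have "rot_prod a (z 0) = (\<lambda>\<alpha>. ?w \<alpha> + (- \<i>) * shift_at (Suc a) ?w \<alpha>)"
      unfolding IH[symmetric] assms(1)[OF a True] norm_prod_lin norm_prod_shift_at ..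
    then show ?thesis
      using True by (simp only: rot_prod.simps norm_prod.simps shift_at_lin if_True)
        (simp add: fun_eq_iff algebra_simps)
  next
    case False
    then show ?thesis
      by (simp add: assms(2)[OF a False] norm_prod_lin norm_prod_shift_at IH)
  qed
qed simp

text \<open>The product of the 1 + t^2 has real coefficients.\<close>

lemma Re_norm_prod: "Re (norm_prod A a F \<alpha>) = Re (norm_prod A a (\<lambda>\<beta>. of_real (Re (F \<beta>))) \<alpha>)"
proof (induction a arbitrary: \<alpha>)
  case (Suc a)
  then show ?case by (simp add: shift_at_def del: fun_upd_apply)
qed simp

text \<open>In the product of the 1 + \<i> t, terms of even degree have real and terms of odd degree
  imaginary coefficients. Hence for real F the real part at \<alpha> sees only arguments of the same
  parity as \<alpha>, and the imaginary part only the others; the constant term 1 gives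
  \<open>F \<alpha>\<close> itself. The two claims are proved together because a factor \<i> t
  interchanges them.\<close>

lemma rot_prod_parity:
  fixes F :: "(nat \<Rightarrow> nat) \<Rightarrow> complex"
  assumes "\<And>\<alpha>. Im (F \<alpha>) = 0" and "a \<le> k"
  shows "((\<forall>\<beta>. even (sum \<beta> {1..k}) = even (sum \<alpha> {1..k}) \<longrightarrow> sum \<beta> {1..k} < sum \<alpha> {1..k} \<longrightarrow> F \<beta> = 0)
            \<longrightarrow> Re (rot_prod a F \<alpha>) = Re (F \<alpha>)) \<and>
         ((\<forall>\<beta>. even (sum \<beta> {1..k}) \<noteq> even (sum \<alpha> {1..k}) \<longrightarrow> sum \<beta> {1..k} < sum \<alpha> {1..k} \<longrightarrow> F \<beta> = 0)
            \<longrightarrow> Im (rot_prod a F \<alpha>) = 0)"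
  using assms(2)
proof (induction a arbitrary: \<alpha>)
  case 0
  then show ?case using assms(1) by simp
next
  case (Suc a)
  then have a: "a \<le> k" by simp
  show ?case
  proof (cases "\<alpha> (Suc a) = 0")
    case True
    then show ?thesis using Suc.IH[OF a, of \<alpha>] by (simp add: shift_at_def)
  next
    case False
    define \<beta> where "\<beta> = \<alpha>(Suc a := \<alpha> (Suc a) - 1)"
    have "sum \<alpha> {1..k} = \<alpha> (Suc a) + sum \<alpha> ({1..k} - {Suc a})"
      using Suc.prems by (subst sum.remove[of _ "Suc a"]) auto
    moreover have "sum \<beta> {1..k} = \<beta> (Suc a) + sum \<beta> ({1..k} - {Suc a})"
      using Suc.prems by (subst sum.remove[of _ "Suc a"]) auto
    moreover have "sum \<beta> ({1..k} - {Suc a}) = sum \<alpha> ({1..k} - {Suc a})"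
      by (rule sum.cong) (auto simp: \<beta>_def)
    ultimately have s: "sum \<alpha> {1..k} = Suc (sum \<beta> {1..k})"
      using False by (simp add: \<beta>_def)
    have r: "rot_prod (Suc a) F \<alpha> = rot_prod a F \<alpha> + \<i> * rot_prod a F \<beta>"
      using False by (simp add: shift_at_def \<beta>_def)
    note IH = Suc.IH[OF a, of \<alpha>] Suc.IH[OF a, of \<beta>]
    show ?thesis
    proof (intro conjI impI)
      assume "\<forall>\<beta>. even (sum \<beta> {1..k}) = even (sum \<alpha> {1..k}) \<longrightarrow>
        sum \<beta> {1..k} < sum \<alpha> {1..k} \<longrightarrow> F \<beta> = 0"
      with IH have "Re (rot_prod a F \<alpha>) = Re (F \<alpha>)" "Im (rot_prod a F \<beta>) = 0"
        unfolding s by (simp_all add: less_Suc_eq)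
      then show "Re (rot_prod (Suc a) F \<alpha>) = Re (F \<alpha>)" unfolding r by simp
    next
      assume h: "\<forall>\<beta>. even (sum \<beta> {1..k}) \<noteq> even (sum \<alpha> {1..k}) \<longrightarrow>
        sum \<beta> {1..k} < sum \<alpha> {1..k} \<longrightarrow> F \<beta> = 0"
      from h[rule_format, of \<beta>] have "F \<beta> = 0" by (simp only: s) simp
      moreover from h IH have "Im (rot_prod a F \<alpha>) = 0" "Re (rot_prod a F \<beta>) = Re (F \<beta>)"
        unfolding s by (simp_all add: less_Suc_eq)
      ultimately show "Im (rot_prod (Suc a) F \<alpha>) = 0" unfolding r by simp
    qed
  qed
qed

text \<open>By \<open>rot_prod_parity\<close> the equation at \<alpha> forces the difference to
  vanish there once it vanishes at all smaller degrees of that parity. An equation on one parity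
  class thus determines the solution on that class.\<close>

lemma rot_prod_unique:
  fixes F G :: "(nat \<Rightarrow> nat) \<Rightarrow> complex"
  assumes "\<And>\<alpha>. Im (F \<alpha>) = 0" "\<And>\<alpha>. Im (G \<alpha>) = 0"
    and eq: "\<And>\<alpha>. even (sum \<alpha> {1..k}) = p \<Longrightarrow> Re (rot_prod k F \<alpha>) = Re (rot_prod k G \<alpha>)"
    and "even (sum \<alpha> {1..k}) = p"
  shows "F \<alpha> = G \<alpha>"
  using assms(4)
proof (induction "sum \<alpha> {1..k}" arbitrary: \<alpha> rule: less_induct)
  case less
  define H where "H = (\<lambda>\<alpha>. F \<alpha> + (-1) * G \<alpha>)"
  have "rot_prod k H \<alpha> = rot_prod k F \<alpha> + (-1) * rot_prod k G \<alpha>"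
    unfolding H_def rot_prod_lin ..
  then have "Re (rot_prod k H \<alpha>) = 0"
    using eq[OF less.prems] by simp
  moreover have "Re (rot_prod k H \<alpha>) = Re (H \<alpha>)"
    using rot_prod_parity[of H k k \<alpha>] less assms(1,2) by (auto simp: H_def)
  ultimately show ?case
    using assms(1,2) by (simp add: H_def complex_eq_iff)
qed

section \<open>Counting words by removing the first letter\<close>

lemma all_nat_split: "(\<forall>i::nat. P i) \<longleftrightarrow> P 0 \<and> (\<forall>i. P (Suc i))"
proof safe
  fix i assume "P 0" "\<forall>i. P (Suc i)"
  then show "P i" by (cases i) auto
qed auto

lemma alternating_Nil [simp]: "alternating A B []" "rev_alternating A B []"
  by (auto simp: alternating_def rev_alternating_def)

lemma alternating_Cons:
  "alternating A B (a # w) \<longleftrightarrow> rev_alternating A B w \<and> (w = [] \<or> gt_conv A a (hd w))"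
proof (cases w)
  case (Cons b v)
  show ?thesis
    unfolding alternating_def rev_alternating_def Cons
    by (subst all_nat_split) (simp add: conj_commute cong: if_cong)
qed (simp add: alternating_def rev_alternating_def)

lemma rev_alternating_Cons:
  "rev_alternating A B (a # w) \<longleftrightarrow> alternating A B w \<and> (w = [] \<or> lt_conv B a (hd w))"
proof (cases w)
  case (Cons b v)
  show ?thesis
    unfolding alternating_def rev_alternating_def Cons
    by (subst all_nat_split) (simp add: conj_commute cong: if_cong)
qed (simp add: alternating_def rev_alternating_def)

lemma length_alpha_perms: "w \<in> alpha_perms k \<alpha> \<Longrightarrow> length w = sum \<alpha> {1..k}"
proof -
  assume w: "w \<in> alpha_perms k \<alpha>"
  then have "sum (count_list w) {1..k} = length w"
    by (intro sum_count_set) (auto simp: alpha_perms_def)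
  moreover have "sum (count_list w) {1..k} = sum \<alpha> {1..k}"
    using w by (intro sum.cong) (auto simp: alpha_perms_def)
  ultimately show ?thesis by simp
qed

lemma finite_alpha_perms: "finite (alpha_perms k \<alpha>)"
proof (rule finite_subset)
  show "alpha_perms k \<alpha> \<subseteq> {w. set w \<subseteq> {1..k} \<and> length w = sum \<alpha> {1..k}}"
    using length_alpha_perms by (auto simp: alpha_perms_def)
qed (rule finite_lists_length_eq, simp)

lemma Cons_in_alpha_perms:
  assumes "a \<in> {1..k}"
  shows "a # w \<in> alpha_perms k \<alpha> \<longleftrightarrow> \<alpha> a \<noteq> 0 \<and> w \<in> alpha_perms k (\<alpha>(a := \<alpha> a - 1))"
proof -
  have "(\<forall>i\<in>{1..k}. count_list (a # w) i = \<alpha> i) \<longleftrightarrow>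
      \<alpha> a = Suc (count_list w a) \<and> (\<forall>i\<in>{1..k} - {a}. count_list w i = \<alpha> i)"
    using assms by auto
  also have "\<dots> \<longleftrightarrow> \<alpha> a \<noteq> 0 \<and> (\<forall>i\<in>{1..k}. count_list w i = (\<alpha>(a := \<alpha> a - 1)) i)"
    using assms by auto
  finally show ?thesis
    using assms unfolding alpha_perms_def by auto
qed

text \<open>The cardinality is the coefficient of the series \<open>y\<^sub>a\<close> introduced at
  the beginning; that of \<open>rev_alt_upto\<close> is the coefficient of
  \<open>x\<^sub>a\<close>.\<close>

definition alt_above :: "nat \<Rightarrow> nat set \<Rightarrow> nat set \<Rightarrow> nat \<Rightarrow> (nat \<Rightarrow> nat) \<Rightarrow> nat list set" where
  "alt_above k A B a \<alpha> = {w \<in> alpha_perms k \<alpha>. alternating A B w \<and> (w = [] \<or> a < hd w)}"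

definition rev_alt_upto :: "nat \<Rightarrow> nat set \<Rightarrow> nat set \<Rightarrow> nat \<Rightarrow> (nat \<Rightarrow> nat) \<Rightarrow> nat list set" where
  "rev_alt_upto k A B a \<alpha> = {w \<in> alpha_perms k \<alpha>. rev_alternating A B w \<and> (w = [] \<or> hd w \<le> a)}"

lemma finite_alt_above: "finite (alt_above k A B a \<alpha>)"
  by (rule finite_subset[OF _ finite_alpha_perms[of k \<alpha>]]) (auto simp: alt_above_def)

lemma finite_rev_alt_upto: "finite (rev_alt_upto k A B a \<alpha>)"
  by (rule finite_subset[OF _ finite_alpha_perms[of k \<alpha>]]) (auto simp: rev_alt_upto_def)

text \<open>The two sets differ in the words starting with \<open>Suc a\<close>. What follows that
  letter is reverse alternating and begins lower, or at most equal if ties count as descents, that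
  is if \<open>Suc a\<close> lies in A; the conditional bound encodes this.\<close>

lemma card_alt_above_step:
  assumes "a < k"
  shows "of_nat (card (alt_above k A B a \<alpha>)) = of_nat (card (alt_above k A B (Suc a) \<alpha>)) +
    shift_at (Suc a) (\<lambda>\<alpha>. of_nat (card (rev_alt_upto k A B (if Suc a \<in> A then Suc a else a) \<alpha>))) \<alpha>"
proof -
  define R where "R = (if \<alpha> (Suc a) = 0 then {} else
    rev_alt_upto k A B (if Suc a \<in> A then Suc a else a) (\<alpha>(Suc a := \<alpha> (Suc a) - 1)))"
  have a: "Suc a \<in> {1..k}" using assms by simp
  have gt: "gt_conv A (Suc a) h \<longleftrightarrow> h \<le> (if Suc a \<in> A then Suc a else a)" for h
    by (cases "h = Suc a") (auto simp: gt_conv_def)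
  have "alt_above k A B a \<alpha> = alt_above k A B (Suc a) \<alpha> \<union> (#) (Suc a) ` R" (is "?L = ?M")
  proof (rule set_eqI)
    fix w show "w \<in> ?L \<longleftrightarrow> w \<in> ?M"
    proof (cases w)
      case (Cons b v)
      then show ?thesis
        using Cons_in_alpha_perms[OF a, of v \<alpha>]
        by (cases "b = Suc a") (auto simp: alt_above_def R_def rev_alt_upto_def alternating_Cons gt)
    qed (auto simp: alt_above_def)
  qed
  moreover have "alt_above k A B (Suc a) \<alpha> \<inter> (#) (Suc a) ` R = {}"
    by (auto simp: alt_above_def)
  moreover have "finite R" by (auto simp: R_def finite_rev_alt_upto)
  ultimately have "card ?L = card (alt_above k A B (Suc a) \<alpha>) + card R"
    by (simp add: card_Un_disjoint finite_alt_above card_image)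
  then show ?thesis by (auto simp: shift_at_def R_def)
qed

text \<open>The mirror image of \<open>card_alt_above_step\<close>: now membership in B decides
  whether the letter \<open>Suc a\<close> may be repeated.\<close>

lemma card_rev_alt_upto_step:
  assumes "a < k"
  shows "of_nat (card (rev_alt_upto k A B (Suc a) \<alpha>)) = of_nat (card (rev_alt_upto k A B a \<alpha>)) +
    shift_at (Suc a) (\<lambda>\<alpha>. of_nat (card (alt_above k A B (if Suc a \<in> B then a else Suc a) \<alpha>))) \<alpha>"
proof -
  define R where "R = (if \<alpha> (Suc a) = 0 then {} else
    alt_above k A B (if Suc a \<in> B then a else Suc a) (\<alpha>(Suc a := \<alpha> (Suc a) - 1)))"
  have a: "Suc a \<in> {1..k}" using assms by simp
  have lt: "lt_conv B (Suc a) h \<longleftrightarrow> (if Suc a \<in> B then a else Suc a) < h" for h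
    by (cases "h = Suc a") (auto simp: lt_conv_def)
  have "rev_alt_upto k A B (Suc a) \<alpha> = rev_alt_upto k A B a \<alpha> \<union> (#) (Suc a) ` R" (is "?L = ?M")
  proof (rule set_eqI)
    fix w show "w \<in> ?L \<longleftrightarrow> w \<in> ?M"
    proof (cases w)
      case (Cons b v)
      then show ?thesis
        using Cons_in_alpha_perms[OF a, of v \<alpha>]
        by (cases "b = Suc a") (auto simp: alt_above_def R_def rev_alt_upto_def rev_alternating_Cons lt)
    qed (auto simp: rev_alt_upto_def)
  qed
  moreover have "rev_alt_upto k A B a \<alpha> \<inter> (#) (Suc a) ` R = {}"
    by (auto simp: rev_alt_upto_def)
  moreover have "finite R" by (auto simp: R_def finite_alt_above)
  ultimately have "card ?L = card (rev_alt_upto k A B a \<alpha>) + card R"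
    by (simp add: card_Un_disjoint finite_rev_alt_upto card_image)
  then show ?thesis by (auto simp: shift_at_def R_def)
qed

text \<open>The coefficients of the constant series 1.\<close>

definition delta :: "nat \<Rightarrow> (nat \<Rightarrow> nat) \<Rightarrow> complex" where
  "delta k \<alpha> = (if \<forall>j\<in>{1..k}. \<alpha> j = 0 then 1 else 0)"

lemma hd_alpha_perms: "w \<in> alpha_perms k \<alpha> \<Longrightarrow> w \<noteq> [] \<Longrightarrow> hd w \<in> {1..k}"
  by (cases w) (auto simp: alpha_perms_def)

lemma Nil_in_alpha_perms: "[] \<in> alpha_perms k \<alpha> \<longleftrightarrow> (\<forall>j\<in>{1..k}. \<alpha> j = 0)"
  by (auto simp: alpha_perms_def)

lemma card_alt_above_top: "of_nat (card (alt_above k A B k \<alpha>)) = delta k \<alpha>"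
proof -
  have "w \<in> alt_above k A B k \<alpha> \<longleftrightarrow> w = [] \<and> [] \<in> alpha_perms k \<alpha>" for w
    using hd_alpha_perms[of w k \<alpha>] by (cases "w = []") (auto simp: alt_above_def)
  then have "alt_above k A B k \<alpha> = (if [] \<in> alpha_perms k \<alpha> then {[]} else {})"
    by auto
  then show ?thesis by (simp add: delta_def Nil_in_alpha_perms)
qed

lemma card_rev_alt_upto_0: "of_nat (card (rev_alt_upto k A B 0 \<alpha>)) = delta k \<alpha>"
proof -
  have "w \<in> rev_alt_upto k A B 0 \<alpha> \<longleftrightarrow> w = [] \<and> [] \<in> alpha_perms k \<alpha>" for w
    using hd_alpha_perms[of w k \<alpha>] by (cases "w = []") (auto simp: rev_alt_upto_def)
  then have "rev_alt_upto k A B 0 \<alpha> = (if [] \<in> alpha_perms k \<alpha> then {[]} else {})"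
    by auto
  then show ?thesis by (simp add: delta_def Nil_in_alpha_perms)
qed

lemma card_alt_above_0: "card (alt_above k A B 0 \<alpha>) = num_alt k \<alpha> A B"
proof -
  have "(w \<in> alpha_perms k \<alpha> \<and> alternating A B w \<and> (w = [] \<or> 0 < hd w)) =
      (w \<in> alpha_perms k \<alpha> \<and> alternating A B w)" for w
    using hd_alpha_perms[of w k \<alpha>] by (cases "w = []") auto
  then show ?thesis by (simp only: alt_above_def num_alt_def)
qed

text \<open>This is the equation \<open>C y\<^sub>0 = D + S\<close>. It is the real part of
  \<open>norm_prod A k (z k) = rot_prod k (z 0)\<close>, in which \<open>z k\<close> has real part 1
  and \<open>z 0\<close> has imaginary part 1, both as series.\<close>

lemma Re_rot_prod_num_alt:
  assumes "A \<union> B = {1..k}" "A \<inter> B = {}"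
  shows "Re (rot_prod k (\<lambda>\<alpha>. of_nat (num_alt k \<alpha> A B)) \<alpha>) =
    Re (norm_prod A k (delta k) \<alpha>) + Im (rot_prod k (delta k) \<alpha>)"
proof -
  define x y :: "nat \<Rightarrow> (nat \<Rightarrow> nat) \<Rightarrow> complex"
    where "x a = (\<lambda>\<alpha>. of_nat (card (rev_alt_upto k A B a \<alpha>)))"
      and "y a = (\<lambda>\<alpha>. of_nat (card (alt_above k A B a \<alpha>)))" for a
  define z where "z a = (\<lambda>\<alpha>. y a \<alpha> + \<i> * x a \<alpha>)" for a
  have y: "y a \<alpha> = y (Suc a) \<alpha> + shift_at (Suc a) (x (if Suc a \<in> A then Suc a else a)) \<alpha>"
    if "a < k" for a \<alpha>
    unfolding x_def y_def by (rule card_alt_above_step[OF that])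
  have x: "x (Suc a) \<alpha> = x a \<alpha> + shift_at (Suc a) (y (if Suc a \<in> B then a else Suc a)) \<alpha>"
    if "a < k" for a \<alpha>
    unfolding x_def y_def by (rule card_rev_alt_upto_step[OF that])
  have "norm_prod A k (z k) = rot_prod k (z 0)"
  proof (rule norm_prod_eq_rot_prod[of k])
    fix a assume a: "a < k"
    { assume "Suc a \<in> A"
      moreover from this have "Suc a \<notin> B" using assms by auto
      ultimately show "z a = (\<lambda>\<alpha>. z (Suc a) \<alpha> + (- \<i>) * shift_at (Suc a) (z (Suc a)) \<alpha>)"
        unfolding z_def shift_at_lin by (simp add: y[OF a] x[OF a] fun_eq_iff algebra_simps) }
    { assume "Suc a \<notin> A"
      moreover from this have "Suc a \<in> B" using assms a by auto
      ultimately show "z (Suc a) = (\<lambda>\<alpha>. z a \<alpha> + \<i> * shift_at (Suc a) (z a) \<alpha>)"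
        unfolding z_def shift_at_lin by (simp add: y[OF a] x[OF a] fun_eq_iff algebra_simps) }
  qed simp
  moreover have "(\<lambda>\<beta>. complex_of_real (Re (z k \<beta>))) = delta k"
    by (simp add: z_def x_def y_def card_alt_above_top fun_eq_iff) (simp add: delta_def)
  moreover have "rot_prod k (z 0) \<alpha> =
      rot_prod k (\<lambda>\<alpha>. of_nat (num_alt k \<alpha> A B)) \<alpha> + \<i> * rot_prod k (delta k) \<alpha>"
    by (simp add: z_def x_def y_def card_alt_above_0 card_rev_alt_upto_0 rot_prod_lin)
  ultimately show ?thesis
    using Re_norm_prod[of A k "z k" \<alpha>] by simp
qed

text \<open>Complementing the letters reverses the order, so ascents and descents change places, and
  with them the tie rules A and B.\<close>

lemma num_rev_alt_complement:
  assumes "A \<union> B = {1..k}"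
  defines "c \<equiv> \<lambda>i. k + 1 - i"
  shows "num_rev_alt k \<alpha> A B = num_alt k (\<alpha> \<circ> c) (c ` B) (c ` A)"
proof -
  \<comment> \<open>Subtraction is truncated, so the facts about \<open>c\<close> are confined to
    the letters from 1 to k.\<close>
  have cc: "c (c i) = i" if "i \<in> {1..k}" for i using that by (auto simp: c_def)
  have c: "c i \<in> {1..k}" if "i \<in> {1..k}" for i using that by (auto simp: c_def)
  have less: "c i < c j \<longleftrightarrow> j < i" and eq: "c i = c j \<longleftrightarrow> i = j"
    if "i \<in> {1..k}" "j \<in> {1..k}" for i j
    using that by (auto simp: c_def)
  have im: "c i \<in> c ` X \<longleftrightarrow> i \<in> X" if "i \<in> {1..k}" "X \<subseteq> {1..k}" for i X
    using that eq by blast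
  have sub: "A \<subseteq> {1..k}" "B \<subseteq> {1..k}" using assms(1) by auto
  have cmp: "gt_conv (c ` B) (c i) (c j) = lt_conv B i j" "lt_conv (c ` A) (c i) (c j) = gt_conv A i j"
    if "i \<in> {1..k}" "j \<in> {1..k}" for i j
    using that by (simp_all only: gt_conv_def lt_conv_def less eq im sub)
  have alt: "alternating (c ` B) (c ` A) (map c w) = rev_alternating A B w" if "set w \<subseteq> {1..k}" for w
  proof -
    have "gt_conv (c ` B) (c (w ! i)) (c (w ! Suc i)) = lt_conv B (w ! i) (w ! Suc i)"
      "lt_conv (c ` A) (c (w ! i)) (c (w ! Suc i)) = gt_conv A (w ! i) (w ! Suc i)"
      if "Suc i < length w" for i
      using \<open>set w \<subseteq> {1..k}\<close> that by (intro cmp; meson Suc_lessD nth_mem subsetD)+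
    then show ?thesis
      by (simp add: alternating_def rev_alternating_def cong: imp_cong)
  qed
  have cnt: "count_list (map c w) i = count_list w (c i)" if "set w \<subseteq> {1..k}" "i \<in> {1..k}" for w i
    using that(1) by (induction w) (use that(2) cc in auto)
  have "bij_betw (map c) {w \<in> alpha_perms k \<alpha>. rev_alternating A B w}
     {w \<in> alpha_perms k (\<alpha> \<circ> c). alternating (c ` B) (c ` A) w}"
  proof (rule bij_betwI[where g = "map c"])
    have inv: "map c (map c w) = w" if "set w \<subseteq> {1..k}" for w
      using that cc by (auto intro!: map_idI)
    have mem: "map c w \<in> alpha_perms k (\<alpha> \<circ> c)" if "w \<in> alpha_perms k \<alpha>" for w \<alpha>
      using that c cnt[of w] by (auto simp del: atLeastAtMost_iff simp: alpha_perms_def subset_iff)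
    have set: "set w \<subseteq> {1..k}" if "w \<in> alpha_perms k \<beta>" for w \<beta>
      using that by (simp add: alpha_perms_def)
    have per: "alpha_perms k ((\<alpha> \<circ> c) \<circ> c) = alpha_perms k \<alpha>"
      using cc by (auto simp: alpha_perms_def)
    show "map c \<in> {w \<in> alpha_perms k \<alpha>. rev_alternating A B w} \<rightarrow>
        {w \<in> alpha_perms k (\<alpha> \<circ> c). alternating (c ` B) (c ` A) w}"
      using mem alt set by auto
    show "map c \<in> {w \<in> alpha_perms k (\<alpha> \<circ> c). alternating (c ` B) (c ` A) w} \<rightarrow>
        {w \<in> alpha_perms k \<alpha>. rev_alternating A B w}"
    proof (clarsimp, intro conjI)
      fix w assume w: "w \<in> alpha_perms k (\<alpha> \<circ> c)" "alternating (c ` B) (c ` A) w"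
      show "map c w \<in> alpha_perms k \<alpha>" using mem[OF w(1)] per by simp
      then show "rev_alternating A B (map c w)"
        using w(2) alt[of "map c w"] inv[OF set[OF w(1)]] set by metis
    qed
  qed (use cc in \<open>auto simp: alpha_perms_def intro!: map_idI\<close>)
  then show ?thesis
    unfolding num_rev_alt_def num_alt_def by (rule bij_betw_same_card)
qed

section \<open>Umbral evaluation\<close>

text \<open>
  The coefficients of the solution \<open>(1 + t\<^sup>2)\<^bsup>\<kappa>/2\<^esup> exp (x arctan t)\<close> of
  \<open>(1 + t\<^sup>2) f' = (x + \<kappa> t) f\<close>, \<open>f 0 = 1\<close>.
\<close>

fun gseq :: "'a::field_char_0 \<Rightarrow> 'a poly \<Rightarrow> nat \<Rightarrow> 'a poly" where
  "gseq \<kappa> x 0 = 1"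
| "gseq \<kappa> x (Suc 0) = x"
| "gseq \<kappa> x (Suc (Suc n)) =
     smult (1 / of_nat (n + 2)) (x * gseq \<kappa> x (Suc n) + smult (\<kappa> - of_nat n) (gseq \<kappa> x n))"

lemma of_nat_poly_mult: "of_nat n * p = smult (of_nat n) (p :: 'a::comm_ring_1 poly)"
  by (simp add: of_nat_poly)

lemma gseq_rec:
  "of_nat (n + 2) * gseq \<kappa> x (n + 2) = x * gseq \<kappa> x (Suc n) + ([:\<kappa>:] - of_nat n) * gseq \<kappa> x n"
proof -
  have "(of_nat (n + 2) :: 'a) \<noteq> 0" by (simp only: of_nat_eq_0_iff)
  then have "smult (of_nat (n + 2)) (gseq \<kappa> x (n + 2)) =
      x * gseq \<kappa> x (Suc n) + smult (\<kappa> - of_nat n) (gseq \<kappa> x n)"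
    by (simp del: of_nat_add of_nat_Suc)
  then show ?thesis
    by (simp only: of_nat_poly_mult left_diff_distrib smult_diff_left) simp
qed

text \<open>The way identities for \<open>gseq\<close> are established below: two initial values and
  the recursion are checked instead of manipulating the series.\<close>

lemma gseq_unique:
  assumes "f 0 = 1" "f (Suc 0) = x"
    and rec: "\<And>n. of_nat (n + 2) * f (n + 2) = x * f (Suc n) + ([:\<kappa>:] - of_nat n) * f n"
  shows "f n = gseq \<kappa> x n"
proof (induction n rule: less_induct)
  case (less n)
  consider "n = 0" | "n = 1" | m where "n = m + 2"
    by (metis One_nat_def add_2_eq_Suc' not0_implies_Suc)
  then show ?case
  proof cases
    case (3 m)
    have "of_nat (m + 2) * f (m + 2) = of_nat (m + 2) * gseq \<kappa> x (m + 2)"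
      unfolding rec gseq_rec using less[of "Suc m"] less[of m] 3 by simp
    then show ?thesis
      unfolding 3 by (subst (asm) mult_cancel_left) (simp only: of_nat_eq_0_iff, simp)
  qed (use assms in auto)
qed

lemma pcompose_of_nat [simp]: "pcompose (of_nat n) p = of_nat n"
  by (simp add: of_nat_poly)

lemma pcompose_gseq: "pcompose (gseq \<kappa> x n) y = gseq \<kappa> (pcompose x y) n"
proof (rule gseq_unique)
  fix n
  have "pcompose (of_nat (n + 2) * gseq \<kappa> x (n + 2)) y =
      pcompose (x * gseq \<kappa> x (Suc n) + ([:\<kappa>:] - of_nat n) * gseq \<kappa> x n) y"
    by (simp only: gseq_rec)
  then show "of_nat (n + 2) * pcompose (gseq \<kappa> x (n + 2)) y =
      pcompose x y * pcompose (gseq \<kappa> x (Suc n)) y + ([:\<kappa>:] - of_nat n) * pcompose (gseq \<kappa> x n) y"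
    by (simp only: pcompose_mult pcompose_add pcompose_diff pcompose_of_nat pcompose_const)
qed (simp_all add: pcompose_1)

definition delay :: "(nat \<Rightarrow> 'a::zero) \<Rightarrow> nat \<Rightarrow> 'a" where
  "delay f n = (if n = 0 then 0 else f (n - 1))"

lemma delay_simps [simp]: "delay f 0 = 0" "delay f (Suc n) = f n"
  by (simp_all add: delay_def)

text \<open>The ring identity behind \<open>gseq_rotate\<close>, with numerals and constants
  abstracted; the two sides differ by a multiple of W * W + 1.\<close>

lemma rotate_step:
  fixes g0 :: "'a::comm_ring_1"
  assumes "n2 * g2 = x * g1 + (K - n) * g0" "n1 * g1 = x * g0 + (K + 1 - n) * d"
    and "n2 = n1 + 1" "W * W = -1"
  shows "n2 * (g2 + W * g1) = (x + W) * (g1 + W * g0) + (K + 1 - n) * (g0 + W * d)"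
proof -
  have "n2 * (g2 + W * g1) = n2 * g2 + W * (n1 * g1) + W * g1"
    unfolding assms(3) by (simp add: algebra_simps)
  also have "\<dots> = (x + W) * (g1 + W * g0) + (K + 1 - n) * (g0 + W * d) - (W * W + 1) * g0"
    unfolding assms(1,2) by (simp add: algebra_simps)
  finally show ?thesis by (simp add: assms(4))
qed

lemma gseq_rotate:
  assumes "w * w = -1"
  shows "gseq \<kappa> x n + smult w (delay (gseq \<kappa> x) n) = gseq (\<kappa> + 1) (x + [:w:]) n"
proof (rule gseq_unique)
  fix n
  let ?g = "gseq \<kappa> x" and ?W = "[:w:]" and ?K = "[:\<kappa>:]"
  have W: "?W * ?W = -1" by (subst one_pCons) (simp add: assms)
  have sm: "smult w p = ?W * p" for p by simp
  have K: "[:\<kappa> + 1:] = ?K + 1" by (subst one_pCons) simp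
  have e2: "of_nat (n + 2) * ?g (n + 2) = x * ?g (Suc n) + (?K - of_nat n) * ?g n"
    by (rule gseq_rec)
  \<comment> \<open>The recursion one index lower; for n = 0 the value 0 of \<open>delay\<close>
    stands in for the missing term.\<close>
  have e1: "of_nat (Suc n) * ?g (Suc n) = x * ?g n + (?K + 1 - of_nat n) * delay ?g n"
  proof (cases n)
    case (Suc m)
    show ?thesis using gseq_rec[of m \<kappa> x] by (simp add: Suc)
  qed simp
  have "of_nat (n + 2) * (?g (n + 2) + ?W * ?g (Suc n)) =
      (x + ?W) * (?g (Suc n) + ?W * ?g n) + (?K + 1 - of_nat n) * (?g n + ?W * delay ?g n)"
    by (rule rotate_step[OF e2 e1 _ W]) simp
  then show "of_nat (n + 2) * (?g (n + 2) + smult w (delay ?g (n + 2))) =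
      (x + ?W) * (?g (Suc n) + smult w (delay ?g (Suc n))) +
      ([:\<kappa> + 1:] - of_nat n) * (?g n + smult w (delay ?g n))"
    unfolding sm K by simp
qed simp_all

lemma gseq_0_0: "gseq 0 0 n = (if n = 0 then 1 else 0)"
  by (rule gseq_unique[symmetric]) auto

lemma gseq_2_0: "gseq 2 0 n = (if n = 0 then 1 else 0) + (if n = 2 then 1 else 0)"
  by (rule gseq_unique[symmetric]) (auto simp: numeral_poly)

lemma gseq_0_odd: "odd n \<Longrightarrow> gseq \<kappa> 0 n = 0"
  by (induction \<kappa> "0 :: 'a::field_char_0 poly" n rule: gseq.induct) auto

lemma Im_gseq_0: "Im \<kappa> = 0 \<Longrightarrow> Im (poly (gseq \<kappa> 0 n) 0) = 0"
proof (induction n rule: less_induct)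
  case (less n)
  consider "n = 0" | "n = 1" | m where "n = Suc (Suc m)"
    by (metis One_nat_def not0_implies_Suc)
  then show ?case
  proof cases
    case (3 m)
    have "1 / complex_of_nat (m + 2) = of_real (1 / real (m + 2))" by simp
    then show ?thesis using less.IH[of m] less.prems unfolding 3 by (simp del: of_nat_add)
  qed auto
qed

section \<open>The images of the elementary and complete symmetric functions\<close>

lemma sum_from_3: "(\<Sum>r=1..n+2. h r) = h 1 + h 2 + (\<Sum>r=1..n. h (r + 2 :: nat) :: 'a::comm_monoid_add)"
  by (induction n) (simp_all add: numeral_2_eq_2 add.assoc)

text \<open>Since b changes sign under a shift by 2, the tail of the Newton sum for n + 2 is the
  negative of the whole sum for n. Newton's identity thereby collapses to the three-term recursion
  of \<open>gseq\<close>.\<close>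

lemma newton_eq_gseq:
  fixes f b :: "nat \<Rightarrow> 'a::field_char_0 poly"
  assumes f0: "f 0 = 1"
    and newton: "\<And>n. of_nat n * f n = (\<Sum>r=1..n. b r * f (n - r))"
    and b: "b 1 = x" "b 2 = [:\<kappa>:]" "\<And>r. r \<ge> 1 \<Longrightarrow> b (r + 2) = - b r"
  shows "f n = gseq \<kappa> x n"
proof (rule gseq_unique)
  show "f (Suc 0) = x" using newton[of 1] b f0 by simp
  fix n
  have "of_nat (n + 2) * f (n + 2) = (\<Sum>r=1..n+2. b r * f (n + 2 - r))" by (rule newton)
  also have "\<dots> = b 1 * f (Suc n) + b 2 * f n + (\<Sum>r=1..n. b (r + 2) * f (n - r))"
    unfolding sum_from_3 by simp
  also have "(\<Sum>r=1..n. b (r + 2) * f (n - r)) = - (\<Sum>r=1..n. b r * f (n - r))"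
    unfolding sum_negf[symmetric] by (intro sum.cong refl) (simp only: b(3) minus_mult_left atLeastAtMost_iff)
  also have "(\<Sum>r=1..n. b r * f (n - r)) = of_nat n * f n" by (simp only: newton)
  finally show "of_nat (n + 2) * f (n + 2) = x * f (Suc n) + ([:\<kappa>:] - of_nat n) * f n"
    by (simp only: b) (simp add: algebra_simps)
qed (rule f0)

text \<open>The Newton identity for \<open>sym_e\<close> carries a minus sign at even indices, so
  here \<kappa> is the negative of \<open>a 2\<close>, whereas for \<open>sym_h\<close> it is
  \<open>a 2\<close> itself.\<close>

lemma psubst_sym_e_eq_gseq:
  assumes "a 1 = x" "a 2 = [:- \<kappa>:]" "\<And>r. r \<ge> 1 \<Longrightarrow> a (r + 2) = - a r"
  shows "psubst (sym_e n) a = gseq \<kappa> x n"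
proof (rule newton_eq_gseq[where b = "\<lambda>r. [:(-1) ^ (r - 1):] * a r"])
  show "psubst (sym_e 0) a = 1" using psubst_xconst[of 1 a] by (simp add: sym_e_0 pCons_one)
  show "of_nat n * psubst (sym_e n) a = (\<Sum>r=1..n. [:(-1) ^ (r - 1):] * a r * psubst (sym_e (n - r)) a)" for n
    by (rule psubst_newton_sym_e)
  show "[:(-1) ^ (r + 2 - 1):] * a (r + 2) = - ([:(-1) ^ (r - 1):] * a r)" if "r \<ge> 1" for r
    using that assms(3)[OF that] by (cases r) auto
qed (use assms in auto)

lemma psubst_sym_h_eq_gseq:
  assumes "a 1 = x" "a 2 = [:\<kappa>:]" "\<And>r. r \<ge> 1 \<Longrightarrow> a (r + 2) = - a r"
  shows "psubst (sym_h n) a = gseq \<kappa> x n"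
proof (rule newton_eq_gseq[where b = "\<lambda>r. [:1:] * a r"])
  show "psubst (sym_h 0) a = 1" using psubst_xconst[of 1 a] by (simp add: sym_h_0 pCons_one)
  show "of_nat n * psubst (sym_h n) a = (\<Sum>r=1..n. [:1:] * a r * psubst (sym_h (n - r)) a)" for n
    by (rule psubst_newton_sym_h)
qed (use assms in auto)

lemma pCons_neg_one: "[:- 1:] = (- 1 :: 'a::comm_ring_1 poly)"
  by (subst one_pCons) simp

lemma psubst_seq_zero:
  "psubst (sym_e n) seq_zero = gseq 0 umbral_E n" "psubst (sym_h n) seq_zero = gseq 0 umbral_E n"
  by (rule psubst_sym_e_eq_gseq psubst_sym_h_eq_gseq; simp add: seq_zero_def)+

lemma psubst_seq_minus:
  "psubst (sym_e n) seq_minus = gseq 1 umbral_E n" "psubst (sym_h n) seq_minus = gseq (-1) umbral_E n"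
  by (rule psubst_sym_e_eq_gseq psubst_sym_h_eq_gseq; simp add: seq_minus_def pCons_one pCons_neg_one)+

lemma psubst_seq_plus:
  "psubst (sym_e n) seq_plus = gseq (-1) umbral_E n" "psubst (sym_h n) seq_plus = gseq 1 umbral_E n"
  by (rule psubst_sym_e_eq_gseq psubst_sym_h_eq_gseq; simp add: seq_plus_def pCons_one pCons_neg_one)+

section \<open>Complex coefficients and Euler numbers\<close>

abbreviation cpoly :: "rat poly \<Rightarrow> complex poly" where
  "cpoly \<equiv> map_poly of_rat"

lemma cpoly_add: "cpoly (p + q) = cpoly p + cpoly q"
  by (rule poly_eqI) (simp add: coeff_map_poly of_rat_add)

lemma cpoly_diff: "cpoly (p - q) = cpoly p - cpoly q"
  by (rule poly_eqI) (simp add: coeff_map_poly of_rat_diff)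

lemma cpoly_mult: "cpoly (p * q) = cpoly p * cpoly q"
  by (rule poly_eqI) (simp add: coeff_map_poly coeff_mult of_rat_sum of_rat_mult)

lemma cpoly_prod: "cpoly (prod f S) = (\<Prod>i\<in>S. cpoly (f i))"
  by (induction S rule: infinite_finite_induct) (auto simp: cpoly_mult)

lemma cpoly_sum: "cpoly (sum f S) = (\<Sum>i\<in>S. cpoly (f i))"
  by (induction S rule: infinite_finite_induct) (auto simp: cpoly_add)

lemma cpoly_const: "cpoly [:c:] = [:of_rat c:]"
  by (simp add: map_poly_pCons)

lemma cpoly_of_nat: "cpoly (of_nat n) = of_nat n"
  by (simp add: of_nat_poly cpoly_const)

lemma cpoly_gseq: "cpoly (gseq \<kappa> x n) = gseq (of_rat \<kappa>) (cpoly x) n"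
proof (rule gseq_unique)
  fix n
  have "cpoly (of_nat (n + 2) * gseq \<kappa> x (n + 2)) =
      cpoly (x * gseq \<kappa> x (Suc n) + ([:\<kappa>:] - of_nat n) * gseq \<kappa> x n)"
    by (simp only: gseq_rec)
  then show "of_nat (n + 2) * cpoly (gseq \<kappa> x (n + 2)) =
      cpoly x * cpoly (gseq \<kappa> x (Suc n)) + ([:of_rat \<kappa>:] - of_nat n) * cpoly (gseq \<kappa> x n)"
    by (simp only: cpoly_mult cpoly_add cpoly_diff cpoly_of_nat cpoly_const)
qed simp_all

text \<open>The complex-linear extension of \<open>umbral\<close>, needed because E is going to be
  shifted by \<i>.\<close>

definition cumbral :: "complex poly \<Rightarrow> complex" where
  "cumbral q = (\<Sum>i\<le>degree q. coeff q i * of_rat (euler_number i))"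

lemma cumbral_bound: "degree q \<le> N \<Longrightarrow> cumbral q = (\<Sum>i\<le>N. coeff q i * of_rat (euler_number i))"
  unfolding cumbral_def by (rule sum.mono_neutral_left) (auto simp: coeff_eq_0)

lemma cumbral_add: "cumbral (p + q) = cumbral p + cumbral q"
proof -
  let ?N = "max (degree p) (degree q)"
  have "cumbral (p + q) = (\<Sum>i\<le>?N. coeff (p + q) i * of_rat (euler_number i))"
    by (rule cumbral_bound) (rule degree_add_le_max)
  then show ?thesis
    by (simp add: cumbral_bound[of p ?N] cumbral_bound[of q ?N] sum.distrib distrib_right)
qed

lemma cumbral_smult: "cumbral (smult c p) = c * cumbral p"
  by (subst cumbral_bound[OF degree_smult_le]) (simp add: cumbral_def sum_distrib_left mult_ac)

lemma cumbral_cpoly: "cumbral (cpoly q) = of_rat (umbral q)"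
  by (subst cumbral_bound[of _ "degree q"])
    (simp_all add: degree_map_poly umbral_def of_rat_sum of_rat_mult coeff_map_poly)

lemma cumbral_sum: "cumbral (sum f S) = (\<Sum>i\<in>S. cumbral (f i))"
  by (induction S rule: infinite_finite_induct) (auto simp: cumbral_add, simp_all add: cumbral_def)

lemma Re_ii_power: "Re (\<i> ^ n) = (if even n then (-1) ^ (n div 2) else 0)"
  by (auto elim!: evenE oddE simp: power_mult)

lemma Im_ii_power: "Im (\<i> ^ n) = (if odd n then (-1) ^ (n div 2) else 0)"
  by (auto elim!: evenE oddE simp: power_mult)

lemma cos_times_euler: "fps_cos 1 * (inverse (fps_cos 1) + fps_tan 1) = 1 + fps_sin (1 :: rat)"
proof -
  have "fps_cos 1 * inverse (fps_cos 1) = (1 :: rat fps)"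
    by (rule inverse_mult_eq_1') simp
  moreover have "fps_tan 1 = fps_sin 1 * inverse (fps_cos (1 :: rat))"
    unfolding fps_tan_def by (rule fps_divide_unit) simp
  ultimately show ?thesis
    by (simp add: distrib_left mult.left_commute)
qed

lemma of_rat_fact: "of_rat (fact n) = (fact n :: 'a::field_char_0)"
  by (metis of_nat_fact of_rat_of_nat_eq)

lemma complex_of_rat_eq: "complex_of_rat q = of_real (of_rat q)"
  by (cases q) (simp add: of_rat_rat)

text \<open>Comparison of coefficients in \<open>cos_times_euler\<close>: the real and imaginary
  parts of \<i>^m, divided by m!, are the coefficients of cosine and sine.\<close>

lemma euler_number_convolution:
  "(\<Sum>j\<le>n. of_nat (n choose j) * of_rat (euler_number j) * Re (\<i> ^ (n - j))) =
     (if n = 0 then 1 else 0) + Im (\<i> ^ n)"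
proof -
  define e :: "rat fps" where "e = inverse (fps_cos 1) + fps_tan 1"
  have eu: "euler_number j = fact j * fps_nth e j" for j
    by (simp add: euler_number_def e_def)
  have c: "of_rat (fps_nth (fps_cos 1) j) = Re (\<i> ^ j) / fact j" for j
    unfolding Re_ii_power by (simp add: fps_cos_def of_rat_divide of_rat_power of_rat_fact)
  have s: "of_rat (fps_nth (fps_sin 1) n) = Im (\<i> ^ n) / fact n"
    unfolding Im_ii_power by (auto elim!: oddE simp: fps_sin_def of_rat_divide of_rat_power of_rat_fact)
  have "(\<Sum>j\<le>n. fps_nth e j * fps_nth (fps_cos 1) (n - j)) = fps_nth (e * fps_cos 1) n"
    by (simp add: fps_mult_nth atLeast0AtMost)
  also have "\<dots> = (if n = 0 then 1 else 0) + fps_nth (fps_sin 1) n"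
    using cos_times_euler by (simp add: e_def mult.commute)
  finally have "(of_rat (\<Sum>j\<le>n. fps_nth e j * fps_nth (fps_cos 1) (n - j)) :: real) =
      of_rat ((if n = 0 then 1 else 0) + fps_nth (fps_sin 1) n)" by simp
  then have main: "(\<Sum>j\<le>n. of_rat (fps_nth e j) * (Re (\<i> ^ (n - j)) / fact (n - j))) =
      (if n = 0 then 1 else 0) + Im (\<i> ^ n) / fact n"
    by (simp add: of_rat_sum of_rat_mult of_rat_add c s split: if_splits)
  have "(\<Sum>j\<le>n. of_nat (n choose j) * of_rat (euler_number j) * Re (\<i> ^ (n - j))) =
      fact n * (\<Sum>j\<le>n. of_rat (fps_nth e j) * (Re (\<i> ^ (n - j)) / fact (n - j)))"
    unfolding sum_distrib_left
    by (intro sum.cong refl) (simp add: binomial_fact eu of_rat_mult of_rat_fact)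
  also have "\<dots> = (if n = 0 then 1 else 0) + Im (\<i> ^ n)"
    unfolding main by (simp add: distrib_left)
  finally show ?thesis .
qed

text \<open>The umbral form of \<open>cos x \<cdot> (sec x + tan x) = 1 + sin x\<close>.\<close>

lemma Re_cumbral_shift:
  "Re (cumbral (pcompose (cpoly q) [:\<i>, 1:])) = Re (poly (cpoly q) 0) + Im (poly (cpoly q) \<i>)"
proof -
  \<comment> \<open>Both sides are additive in q and rational factors pass through real and
    imaginary parts, so monomials suffice.\<close>
  have mono: "Re (cumbral (pcompose (cpoly (monom c n)) [:\<i>, 1:])) =
      Re (poly (cpoly (monom c n)) 0) + Im (poly (cpoly (monom c n)) \<i>)" for c n
  proof -
    have m: "pcompose (cpoly (monom c n)) y = smult (of_rat c) (y ^ n)" for y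
      by (simp add: map_poly_monom pcompose_altdef poly_monom) 
    have "cumbral ([:\<i>, 1:] ^ n) = (\<Sum>j\<le>n. coeff ([:\<i>, 1:] ^ n) j * of_rat (euler_number j))"
      by (rule cumbral_bound) (simp add: degree_linear_power)
    also have "\<dots> = (\<Sum>j\<le>n. of_nat (n choose j) * \<i> ^ (n - j) * of_rat (euler_number j))"
      by (intro sum.cong refl) (simp add: coeff_linear_poly_power)
    finally have "Re (cumbral ([:\<i>, 1:] ^ n)) =
        (\<Sum>j\<le>n. of_nat (n choose j) * of_rat (euler_number j) * Re (\<i> ^ (n - j)))"
      by (simp add: mult_ac complex_of_rat_eq)
    also have "\<dots> = (if n = 0 then 1 else 0) + Im (\<i> ^ n)" by (rule euler_number_convolution)
    finally show ?thesis
      unfolding m cumbral_smult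
      by (simp add: map_poly_monom poly_monom distrib_left complex_of_rat_eq power_0_left)
  qed
  have "Re (cumbral (pcompose (cpoly (\<Sum>i\<le>degree q. monom (coeff q i) i)) [:\<i>, 1:])) =
      Re (poly (cpoly (\<Sum>i\<le>degree q. monom (coeff q i) i)) 0) +
      Im (poly (cpoly (\<Sum>i\<le>degree q. monom (coeff q i) i)) \<i>)"
    by (simp add: cpoly_sum pcompose_sum cumbral_sum poly_sum mono sum.distrib)
  then show ?thesis by (simp only: poly_as_sum_of_monoms)
qed

section \<open>Product operators applied to products with one factor per letter\<close>

text \<open>The rules are needed for \<open>cumbral\<close>, on the umbral side, and for evaluation
  at 0, which yields the explicit products C + \<i> S and D.\<close>

locale lin_functional =
  fixes L :: "complex poly \<Rightarrow> complex"
  assumes add: "L (p + q) = L p + L q" and smult: "L (smult c p) = c * L p"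
begin

lemma zero: "L 0 = 0"
  using smult[of 0 0] by simp

text \<open>Lowering the exponent of letter j affects only the factor belonging to j.\<close>

lemma shift_at_prod:
  fixes c :: "nat \<Rightarrow> nat \<Rightarrow> complex poly"
  assumes "j \<in> {1..k}"
  shows "shift_at j (\<lambda>\<alpha>. L (\<Prod>l=1..k. c l (\<alpha> l))) \<alpha> =
    L (delay (c j) (\<alpha> j) * (\<Prod>l\<in>{1..k} - {j}. c l (\<alpha> l)))"
proof (cases "\<alpha> j = 0")
  case True
  then show ?thesis by (simp add: shift_at_def zero)
next
  case False
  let ?\<beta> = "\<alpha>(j := \<alpha> j - 1)"
  have "(\<Prod>l=1..k. c l (?\<beta> l)) = c j (?\<beta> j) * (\<Prod>l\<in>{1..k} - {j}. c l (?\<beta> l))"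
    using assms by (intro prod.remove) auto
  also have "(\<Prod>l\<in>{1..k} - {j}. c l (?\<beta> l)) = (\<Prod>l\<in>{1..k} - {j}. c l (\<alpha> l))"
    by (rule prod.cong) auto
  finally show ?thesis using False by (simp add: shift_at_def delay_def)
qed

lemma prod_update:
  fixes c :: "nat \<Rightarrow> nat \<Rightarrow> complex poly"
  assumes "j \<in> {1..k}"
  shows "(\<Prod>l=1..k. (c(j := f)) l (\<alpha> l)) = f (\<alpha> j) * (\<Prod>l\<in>{1..k} - {j}. c l (\<alpha> l))"
proof -
  have "(\<Prod>l=1..k. (c(j := f)) l (\<alpha> l)) =
      (c(j := f)) j (\<alpha> j) * (\<Prod>l\<in>{1..k} - {j}. (c(j := f)) l (\<alpha> l))"
    using assms by (intro prod.remove) auto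
  also have "(\<Prod>l\<in>{1..k} - {j}. (c(j := f)) l (\<alpha> l)) = (\<Prod>l\<in>{1..k} - {j}. c l (\<alpha> l))"
    by (rule prod.cong) auto
  finally show ?thesis by simp
qed

lemma shift_at_prod_update:
  assumes "j \<in> {1..k}"
  shows "shift_at j (\<lambda>\<alpha>. L (\<Prod>l=1..k. c l (\<alpha> l))) =
    (\<lambda>\<alpha>. L (\<Prod>l=1..k. (c(j := delay (c j))) l (\<alpha> l)))"
  by (rule ext) (simp only: shift_at_prod[OF assms] prod_update[OF assms])

lemma add_smult_prod:
  fixes c :: "nat \<Rightarrow> nat \<Rightarrow> complex poly"
  assumes "j \<in> {1..k}"
  shows "L (\<Prod>l=1..k. c l (\<alpha> l)) + a * L (\<Prod>l=1..k. (c(j := f)) l (\<alpha> l)) =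
    L (\<Prod>l=1..k. (c(j := \<lambda>n. c j n + smult a (f n))) l (\<alpha> l))"
proof -
  have "(\<Prod>l=1..k. c l (\<alpha> l)) = c j (\<alpha> j) * (\<Prod>l\<in>{1..k} - {j}. c l (\<alpha> l))"
    using prod_update[OF assms, of c "c j"] by simp
  then show ?thesis
    unfolding prod_update[OF assms] by (simp add: distrib_right add smult)
qed

text \<open>By linearity of L in each factor, multiplication by \<open>1 + \<i> t\<^sub>j\<close>
  replaces the coefficient sequence of factor j and leaves the other factors alone.\<close>

lemma rot_prod_prod:
  "a \<le> k \<Longrightarrow> rot_prod a (\<lambda>\<alpha>. L (\<Prod>j=1..k. c j (\<alpha> j))) =
    (\<lambda>\<alpha>. L (\<Prod>j=1..k. (if j \<le> a then c j (\<alpha> j) + smult \<i> (delay (c j) (\<alpha> j)) else c j (\<alpha> j))))"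
proof (induction a)
  case 0
  show ?case by (intro ext) (simp cong: prod.cong_simp)
next
  case (Suc a)
  define d where "d a = (\<lambda>j n. if j \<le> a then c j n + smult \<i> (delay (c j) n) else c j n)" for a
  have mem: "Suc a \<in> {1..k}" using Suc.prems by simp
  have IH: "rot_prod a (\<lambda>\<alpha>. L (\<Prod>j=1..k. c j (\<alpha> j))) = (\<lambda>\<alpha>. L (\<Prod>j=1..k. d a j (\<alpha> j)))"
    using Suc by (simp add: d_def)
  have "(d a)(Suc a := \<lambda>n. d a (Suc a) n + smult \<i> (delay (d a (Suc a)) n)) = d (Suc a)"
    by (auto simp: d_def fun_eq_iff delay_def)
  then show ?case
    unfolding rot_prod.simps IH shift_at_prod_update[OF mem] add_smult_prod[OF mem]
    by (simp add: d_def)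
qed

lemma norm_prod_prod:
  "a \<le> k \<Longrightarrow> norm_prod A a (\<lambda>\<alpha>. L (\<Prod>j=1..k. c j (\<alpha> j))) =
    (\<lambda>\<alpha>. L (\<Prod>j=1..k. (if j \<le> a \<and> j \<in> A then c j (\<alpha> j) + delay (delay (c j)) (\<alpha> j) else c j (\<alpha> j))))"
proof (induction a)
  case 0
  show ?case by (intro ext) (simp cong: prod.cong_simp)
next
  case (Suc a)
  define d where "d a = (\<lambda>j n. if j \<le> a \<and> j \<in> A then c j n + delay (delay (c j)) n else c j n)" for a
  have mem: "Suc a \<in> {1..k}" using Suc.prems by simp
  have IH: "norm_prod A a (\<lambda>\<alpha>. L (\<Prod>j=1..k. c j (\<alpha> j))) = (\<lambda>\<alpha>. L (\<Prod>j=1..k. d a j (\<alpha> j)))"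
    using Suc by (simp add: d_def)
  show ?case
  proof (cases "Suc a \<in> A")
    case True
    \<comment> \<open>The scalar 1 gives the sum the form required by
      \<open>add_smult_prod\<close>.\<close>
    have "(d a)(Suc a := \<lambda>n. d a (Suc a) n + smult 1 (delay (delay (d a (Suc a))) n)) = d (Suc a)"
      using True by (auto simp: d_def fun_eq_iff delay_def)
    moreover have "norm_prod A (Suc a) (\<lambda>\<alpha>. L (\<Prod>j=1..k. c j (\<alpha> j))) =
      (\<lambda>\<alpha>. L (\<Prod>j=1..k. d a j (\<alpha> j)) +
        1 * L (\<Prod>j=1..k. ((d a)(Suc a := delay (delay (d a (Suc a))))) j (\<alpha> j)))"
      using True by (simp only: norm_prod.simps IH shift_at_prod_update[OF mem] if_True
          fun_upd_same fun_upd_upd mult_1)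
    ultimately show ?thesis
      unfolding add_smult_prod[OF mem] by (simp add: d_def)
  next
    case False
    then have "d (Suc a) = d a"
      by (auto simp: d_def fun_eq_iff le_Suc_eq)
    then have "norm_prod A (Suc a) (\<lambda>\<alpha>. L (\<Prod>j=1..k. c j (\<alpha> j))) =
        (\<lambda>\<alpha>. L (\<Prod>j=1..k. d (Suc a) j (\<alpha> j)))"
      using False IH by simp
    then show ?thesis by (simp only: d_def)
  qed
qed

end

interpretation cumbral: lin_functional cumbral
  by standard (auto simp: cumbral_add cumbral_smult)

interpretation at_0: lin_functional "\<lambda>p. poly p 0"
  by standard auto

section \<open>Comparison of the two sides\<close>

text \<open>Writing the series 1 in terms of \<open>gseq\<close> makes the product rules and
  \<open>gseq_rotate\<close> applicable to it as well.\<close>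

lemma delta_eq: "delta k = (\<lambda>\<alpha>. poly (\<Prod>j=1..k. gseq 0 0 (\<alpha> j)) 0)"
  by (rule ext) (auto simp: delta_def gseq_0_0 poly_prod intro!: prod.neutral)

lemma rot_prod_delta: "rot_prod k (delta k) \<alpha> = (\<Prod>j=1..k. poly (gseq 1 [:\<i>:] (\<alpha> j)) 0)"
proof -
  have "gseq 0 0 n + smult \<i> (delay (gseq 0 0) n) = gseq 1 [:\<i>:] n" for n
    using gseq_rotate[of \<i> 0 0 n] by simp
  then show ?thesis
    unfolding delta_eq at_0.rot_prod_prod[OF order_refl, where c = "\<lambda>j. gseq 0 0"] unfolding poly_prod by (intro prod.cong) auto
qed

lemma norm_prod_delta:
  "norm_prod A k (delta k) \<alpha> = (\<Prod>j=1..k. poly (gseq (if j \<in> A then 2 else 0) 0 (\<alpha> j)) 0)"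
proof -
  have "gseq 0 0 n + delay (delay (gseq 0 0)) n = (gseq 2 0 n :: complex poly)" for n
    by (auto simp: gseq_0_0 gseq_2_0 delay_def)
  then show ?thesis
    unfolding delta_eq at_0.norm_prod_prod[OF order_refl, where c = "\<lambda>j. gseq 0 0"] unfolding poly_prod by (intro prod.cong) auto
qed

lemma Re_rot_prod_umbral:
  fixes \<kappa> :: "nat \<Rightarrow> rat"
  shows "Re (rot_prod k (\<lambda>\<alpha>. of_rat (umbral (\<Prod>j=1..k. gseq (\<kappa> j) umbral_E (\<alpha> j)))) \<alpha>) =
    Re (\<Prod>j=1..k. poly (gseq (of_rat (\<kappa> j) + 1) 0 (\<alpha> j)) 0) +
    Im (\<Prod>j=1..k. poly (gseq (of_rat (\<kappa> j) + 1) [:\<i>:] (\<alpha> j)) 0)"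
proof -
  have E: "cpoly umbral_E = [:0, 1:]" by (simp add: umbral_E_def map_poly_pCons)
  have "(\<lambda>\<alpha>. of_rat (umbral (\<Prod>j=1..k. gseq (\<kappa> j) umbral_E (\<alpha> j)))) =
      (\<lambda>\<alpha>. cumbral (\<Prod>j=1..k. gseq (of_rat (\<kappa> j)) [:0, 1:] (\<alpha> j)))"
    by (simp add: cumbral_cpoly[symmetric] cpoly_prod cpoly_gseq E)
  then have "rot_prod k (\<lambda>\<alpha>. of_rat (umbral (\<Prod>j=1..k. gseq (\<kappa> j) umbral_E (\<alpha> j)))) \<alpha> =
      cumbral (\<Prod>j=1..k. gseq (of_rat (\<kappa> j)) [:0, 1:] (\<alpha> j) +
        smult \<i> (delay (gseq (of_rat (\<kappa> j)) [:0, 1:]) (\<alpha> j)))"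
    using cumbral.rot_prod_prod[OF order_refl, of k "\<lambda>j. gseq (of_rat (\<kappa> j)) [:0, 1:]"]
    by (auto intro!: arg_cong[where f = cumbral] prod.cong)
  also have "\<dots> = cumbral (\<Prod>j=1..k. gseq (of_rat (\<kappa> j) + 1) [:\<i>, 1:] (\<alpha> j))"
    by (simp add: gseq_rotate)
  \<comment> \<open>The rotated product arises from a polynomial with rational coefficients by
    replacing E with E + \<i>, which is the situation of \<open>Re_cumbral_shift\<close>.\<close>
  also have "(\<Prod>j=1..k. gseq (of_rat (\<kappa> j) + 1) [:\<i>, 1:] (\<alpha> j)) =
      pcompose (cpoly (\<Prod>j=1..k. gseq (\<kappa> j + 1) umbral_E (\<alpha> j))) [:\<i>, 1:]"
    by (simp add: cpoly_prod cpoly_gseq E pcompose_prod pcompose_gseq of_rat_add pcompose_pCons)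
  finally have "Re (rot_prod k (\<lambda>\<alpha>. of_rat (umbral (\<Prod>j=1..k. gseq (\<kappa> j) umbral_E (\<alpha> j)))) \<alpha>) =
      Re (poly (cpoly (\<Prod>j=1..k. gseq (\<kappa> j + 1) umbral_E (\<alpha> j))) 0) +
      Im (poly (cpoly (\<Prod>j=1..k. gseq (\<kappa> j + 1) umbral_E (\<alpha> j))) \<i>)"
    by (simp only: Re_cumbral_shift)
  moreover have "poly (cpoly (\<Prod>j=1..k. gseq (\<kappa> j + 1) umbral_E (\<alpha> j))) z =
      (\<Prod>j=1..k. poly (gseq (of_rat (\<kappa> j) + 1) [:z:] (\<alpha> j)) 0)" for z
  proof -
    have "poly (gseq c [:0, 1:] n) z = poly (gseq c [:z:] n) 0" for c n
      using pcompose_gseq[of c "[:0, 1:]" n "[:z:]"] poly_pcompose[of "gseq c [:0, 1:] n" "[:z:]" 0]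
      by (simp add: pcompose_pCons)
    then show ?thesis by (simp add: cpoly_prod poly_prod cpoly_gseq E of_rat_add)
  qed
  ultimately show ?thesis by simp
qed

text \<open>The series is 1 + \<i> t times an even series with real coefficients, so its even
  coefficients are real and its odd ones imaginary.\<close>

lemma gseq_rotated_phase:
  assumes "Im \<kappa> = 0"
  shows "\<exists>r. poly (gseq (\<kappa> + 1) [:\<i>:] n) 0 = of_real r * \<i> ^ n"
proof -
  have e: "poly (gseq (\<kappa> + 1) [:\<i>:] n) 0 = poly (gseq \<kappa> 0 n) 0 + \<i> * poly (delay (gseq \<kappa> 0) n) 0"
    using gseq_rotate[of \<i> \<kappa> 0 n] by (metis add_0 i_squared poly_add poly_smult)
  have re: "poly (gseq \<kappa> 0 m) 0 = of_real (Re (poly (gseq \<kappa> 0 m) 0))" for m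
    using Im_gseq_0[OF assms, of m] by (simp add: complex_eq_iff)
  show ?thesis
  proof (cases "even n")
    case True
    then have "delay (gseq \<kappa> 0) n = 0" by (auto simp: delay_def gseq_0_odd)
    then have "poly (gseq (\<kappa> + 1) [:\<i>:] n) 0 = of_real (Re (poly (gseq \<kappa> 0 n) 0))"
      using e re[of n] by simp
    moreover have "\<i> ^ n = of_real ((-1) ^ (n div 2))"
      using True by (auto elim!: evenE simp: power_mult)
    ultimately show ?thesis
      by (intro exI[of _ "Re (poly (gseq \<kappa> 0 n) 0) * (-1) ^ (n div 2)"]) (simp flip: power_add mult_2)
  next
    case False
    then have "gseq \<kappa> 0 n = 0" "delay (gseq \<kappa> 0) n = gseq \<kappa> 0 (n - 1)"
      by (auto simp: gseq_0_odd delay_def elim!: oddE)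
    then have "poly (gseq (\<kappa> + 1) [:\<i>:] n) 0 = \<i> * of_real (Re (poly (gseq \<kappa> 0 (n - 1)) 0))"
      using e re[of "n - 1"] by simp
    moreover have "\<i> ^ n = \<i> * of_real ((-1) ^ (n div 2))"
      using False by (auto elim!: oddE simp: power_mult)
    ultimately show ?thesis
      by (intro exI[of _ "Re (poly (gseq \<kappa> 0 (n - 1)) 0) * (-1) ^ (n div 2)"])
        (simp flip: power_add mult_2)
  qed
qed

lemma Im_prod_gseq_rotated:
  assumes "\<And>j. Im (\<kappa> j) = 0" "even (sum \<alpha> {1..k})"
  shows "Im (\<Prod>j=1..k. poly (gseq (\<kappa> j + 1) [:\<i>:] (\<alpha> j)) 0) = 0"
proof -
  obtain r where r: "poly (gseq (\<kappa> j + 1) [:\<i>:] (\<alpha> j)) 0 = of_real (r j) * \<i> ^ \<alpha> j" for j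
    using choice[of "\<lambda>j r. poly (gseq (\<kappa> j + 1) [:\<i>:] (\<alpha> j)) 0 = of_real r * \<i> ^ \<alpha> j"]
      gseq_rotated_phase[OF assms(1)] by blast
  have "(\<Prod>j=1..k. poly (gseq (\<kappa> j + 1) [:\<i>:] (\<alpha> j)) 0) =
      of_real (\<Prod>j=1..k. r j) * \<i> ^ (sum \<alpha> {1..k})"
    by (simp add: r prod.distrib power_sum)
  then show ?thesis
    using assms(2) by (simp add: Im_ii_power del: of_real_prod)
qed

lemma ex_odd_summand: "odd (sum \<alpha> S) \<Longrightarrow> \<exists>j\<in>S. odd (\<alpha> j :: nat)"
  by (meson dvd_sum)

text \<open>If the total is odd, some exponent is odd; the real terms of both equations are then 0,
  each containing an odd coefficient of an even series. The imaginary terms coincide because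
  \<kappa> + 1 = 1.\<close>

lemma num_alt_odd:
  assumes "A \<union> B = {1..k}" "A \<inter> B = {}" "odd (sum \<alpha> {1..k})"
  shows "of_nat (num_alt k \<alpha> A B) = umbral (\<Prod>j=1..k. gseq 0 umbral_E (\<alpha> j))"
proof -
  have "(of_nat (num_alt k \<alpha> A B) :: complex) = of_rat (umbral (\<Prod>j=1..k. gseq 0 umbral_E (\<alpha> j)))"
  proof (rule rot_prod_unique[where k = k and p = False and F = "\<lambda>\<alpha>. of_nat (num_alt k \<alpha> A B)"
        and G = "\<lambda>\<alpha>. of_rat (umbral (\<Prod>j=1..k. gseq 0 umbral_E (\<alpha> j)))"])
    fix \<alpha> :: "nat \<Rightarrow> nat" assume "even (sum \<alpha> {1..k}) = False"
    then obtain j where j: "j \<in> {1..k}" "odd (\<alpha> j)" using ex_odd_summand by blast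
    have zero: "(\<Prod>j=1..k. poly (gseq (\<kappa> j :: complex) 0 (\<alpha> j)) 0) = 0" for \<kappa>
      using j by (intro prod_zero bexI[of _ j]) (auto simp: gseq_0_odd)
    show "Re (rot_prod k (\<lambda>\<alpha>. of_nat (num_alt k \<alpha> A B)) \<alpha>) =
        Re (rot_prod k (\<lambda>\<alpha>. of_rat (umbral (\<Prod>j=1..k. gseq 0 umbral_E (\<alpha> j)))) \<alpha>)"
      unfolding Re_rot_prod_num_alt[OF assms(1,2)] Re_rot_prod_umbral[of k "\<lambda>_. 0"]
        norm_prod_delta rot_prod_delta by (simp only: zero of_rat_0 add_0_left)
  qed (use assms in \<open>auto simp: complex_of_rat_eq\<close>)
  then have "complex_of_rat (of_nat (num_alt k \<alpha> A B)) = of_rat (umbral (\<Prod>j=1..k. gseq 0 umbral_E (\<alpha> j)))"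
    by simp
  then show ?thesis by (simp only: of_rat_eq_iff)
qed

text \<open>If the total is even, the imaginary terms vanish by \<open>Im_prod_gseq_rotated\<close>.
  The real terms coincide because \<kappa> + 1 is 2 on A and 0 elsewhere, which are the parameters
  in \<open>norm_prod_delta\<close>.\<close>

lemma num_alt_even:
  assumes "A \<union> B = {1..k}" "A \<inter> B = {}" "even (sum \<alpha> {1..k})"
  shows "of_nat (num_alt k \<alpha> A B) = umbral (\<Prod>j=1..k. gseq (if j \<in> A then 1 else -1) umbral_E (\<alpha> j))"
proof -
  let ?\<kappa> = "\<lambda>j. if j \<in> A then 1 else -1 :: rat"
  have "(of_nat (num_alt k \<alpha> A B) :: complex) = of_rat (umbral (\<Prod>j=1..k. gseq (?\<kappa> j) umbral_E (\<alpha> j)))"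
  proof (rule rot_prod_unique[where k = k and p = True and F = "\<lambda>\<alpha>. of_nat (num_alt k \<alpha> A B)"
        and G = "\<lambda>\<alpha>. of_rat (umbral (\<Prod>j=1..k. gseq (?\<kappa> j) umbral_E (\<alpha> j)))"])
    fix \<alpha> :: "nat \<Rightarrow> nat" assume "even (sum \<alpha> {1..k}) = True"
    then have ev: "even (sum \<alpha> {1..k})" by simp
    have "Im (\<Prod>j=1..k. poly (gseq 1 [:\<i>:] (\<alpha> j)) 0) = 0"
      using Im_prod_gseq_rotated[OF _ ev, of "\<lambda>_. 0"] by simp
    moreover have "Im (\<Prod>j=1..k. poly (gseq (of_rat (?\<kappa> j) + 1) [:\<i>:] (\<alpha> j)) 0) = 0"
      by (rule Im_prod_gseq_rotated[OF _ ev]) simp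
    moreover have "complex_of_rat (?\<kappa> j) + 1 = (if j \<in> A then 2 else 0)" for j by simp
    ultimately show "Re (rot_prod k (\<lambda>\<alpha>. of_nat (num_alt k \<alpha> A B)) \<alpha>) =
        Re (rot_prod k (\<lambda>\<alpha>. of_rat (umbral (\<Prod>j=1..k. gseq (?\<kappa> j) umbral_E (\<alpha> j)))) \<alpha>)"
      unfolding Re_rot_prod_num_alt[OF assms(1,2)] Re_rot_prod_umbral[of k ?\<kappa>]
        norm_prod_delta rot_prod_delta by simp
  qed (use assms in \<open>auto simp: complex_of_rat_eq\<close>)
  then have "complex_of_rat (of_nat (num_alt k \<alpha> A B)) =
      of_rat (umbral (\<Prod>j=1..k. gseq (?\<kappa> j) umbral_E (\<alpha> j)))"
    by simp
  then show ?thesis by (simp only: of_rat_eq_iff)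
qed

section \<open>Assembly of the odd and even cases\<close>

theorem theorem7p3:
  fixes k n :: nat and \<alpha> :: "nat \<Rightarrow> nat" and A B :: "nat set"
  assumes "\<forall>i\<in>{1..k}. \<alpha> i \<ge> 1"
    and "(\<Sum>i=1..k. \<alpha> i) = n"
    and "A \<union> B = {1..k}"
    and "A \<inter> B = {}"
  shows "(odd n \<longrightarrow>
            num_alt k \<alpha> A B = num_rev_alt k \<alpha> A B \<and>
            of_nat (num_rev_alt k \<alpha> A B) =
              umbral (psubst ((\<Prod>i\<in>A. sym_e (\<alpha> i)) * (\<Prod>j\<in>B. sym_h (\<alpha> j))) seq_zero)) \<and>
         (even n \<longrightarrow>
            of_nat (num_alt k \<alpha> A B) =
              umbral (psubst ((\<Prod>i\<in>A. sym_e (\<alpha> i)) * (\<Prod>j\<in>B. sym_h (\<alpha> j))) seq_minus) \<and>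
            of_nat (num_rev_alt k \<alpha> A B) =
              umbral (psubst ((\<Prod>i\<in>A. sym_e (\<alpha> i)) * (\<Prod>j\<in>B. sym_h (\<alpha> j))) seq_plus))"
proof -
  define c where "c = (\<lambda>i. k + 1 - i)"
  have c: "c i \<in> {1..k}" "c (c i) = i" if "i \<in> {1..k}" for i
    using that by (auto simp: c_def)
  have sub: "A \<subseteq> {1..k}" "B \<subseteq> {1..k}" using assms(3) by auto
  have fin: "finite A" "finite B" using sub finite_subset by auto
  have bij: "bij_betw c {1..k} {1..k}"
    by (rule bij_betwI[where g = c]) (use c in auto)
  have inj: "inj_on c {1..k}" using bij by (rule bij_betw_imp_inj_on)
  have im: "c ` {1..k} = {1..k}" using bij by (rule bij_betw_imp_surj_on)
  have cAB: "c ` B \<union> c ` A = {1..k}"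
    unfolding image_Un[symmetric] using assms(3) im by (simp add: Un_commute)
  have cdisj: "c ` B \<inter> c ` A = {}"
    using inj_on_image_Int[OF inj sub(2,1)] assms(4) by (simp add: Int_commute)
  have memB: "c j \<in> c ` B \<longleftrightarrow> j \<notin> A" if "j \<in> {1..k}" for j
    using inj_on_image_mem_iff[OF inj that sub(2)] that assms(3,4) by auto
  have sum_c: "sum (\<alpha> \<circ> c) {1..k} = n"
    using sum.reindex_bij_betw[OF bij, of \<alpha>] assms(2) by simp
  have prod_c: "(\<Prod>j=1..k. g (c j) j) = (\<Prod>j=1..k. g j (c j))" for g :: "nat \<Rightarrow> nat \<Rightarrow> rat poly"
    using prod.reindex_bij_betw[OF bij, of "\<lambda>j. g j (c j)"] c
    by (simp cong: prod.cong_simp)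
  note rev = num_rev_alt_complement[OF assms(3), folded c_def]
  have subst: "psubst ((\<Prod>i\<in>A. sym_e (\<alpha> i)) * (\<Prod>j\<in>B. sym_h (\<alpha> j))) a =
      (\<Prod>j=1..k. if j \<in> A then psubst (sym_e (\<alpha> j)) a else psubst (sym_h (\<alpha> j)) a)" for a
  proof -
    have "psubst ((\<Prod>i\<in>A. sym_e (\<alpha> i)) * (\<Prod>j\<in>B. sym_h (\<alpha> j))) a =
        (\<Prod>i\<in>A. psubst (sym_e (\<alpha> i)) a) * (\<Prod>j\<in>B. psubst (sym_h (\<alpha> j)) a)"
      by (simp add: psubst_mult psubst_prod has_expansion_prod has_expansion_sym_e has_expansion_sym_h)
    also have "\<dots> = (\<Prod>j\<in>A \<union> B. if j \<in> A then psubst (sym_e (\<alpha> j)) a else psubst (sym_h (\<alpha> j)) a)"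
      unfolding prod.union_disjoint[OF fin assms(4)]
      by (intro arg_cong2[where f = "(*)"] prod.cong refl) (use assms(4) in auto)
    finally show ?thesis by (simp only: assms(3))
  qed
  show ?thesis
  proof (intro conjI impI)
    assume odd: "odd n"
    have alt: "of_nat (num_alt k \<alpha> A B) = umbral (\<Prod>j=1..k. gseq 0 umbral_E (\<alpha> j))"
      using num_alt_odd[OF assms(3,4)] odd assms(2) by simp
    \<comment> \<open>For odd n every letter has parameter 0 whether it lies in A or B, so
      complementing the letters merely permutes the factors.\<close>
    have ralt: "of_nat (num_rev_alt k \<alpha> A B) = umbral (\<Prod>j=1..k. gseq 0 umbral_E (\<alpha> j))"
      using num_alt_odd[OF cAB cdisj, of "\<alpha> \<circ> c"] odd sum_c
        prod_c[of "\<lambda>i j. gseq 0 umbral_E (\<alpha> i)"] c by (simp add: rev cong: prod.cong_simp)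
    have "(of_nat (num_alt k \<alpha> A B) :: rat) = of_nat (num_rev_alt k \<alpha> A B)"
      using alt ralt by simp
    then show "num_alt k \<alpha> A B = num_rev_alt k \<alpha> A B" by (simp only: of_nat_eq_iff)
    show "of_nat (num_rev_alt k \<alpha> A B) =
        umbral (psubst ((\<Prod>i\<in>A. sym_e (\<alpha> i)) * (\<Prod>j\<in>B. sym_h (\<alpha> j))) seq_zero)"
      unfolding subst psubst_seq_zero ralt by simp
  next
    assume even: "even n"
    have "(\<Prod>j=1..k. gseq (if j \<in> A then 1 else -1) umbral_E (\<alpha> j)) =
        (\<Prod>j=1..k. if j \<in> A then gseq 1 umbral_E (\<alpha> j) else gseq (-1) umbral_E (\<alpha> j))"
      by (intro prod.cong) auto
    then show "of_nat (num_alt k \<alpha> A B) =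
        umbral (psubst ((\<Prod>i\<in>A. sym_e (\<alpha> i)) * (\<Prod>j\<in>B. sym_h (\<alpha> j))) seq_minus)"
      unfolding subst psubst_seq_minus
      using num_alt_even[OF assms(3,4), of \<alpha>] even assms(2) by simp
    \<comment> \<open>After complementation the letters from B have parameter 1 and those from A
      parameter -1; these are the parameters of \<open>sym_h\<close> and \<open>sym_e\<close> under
      \<open>seq_plus\<close>.\<close>
    have "(\<Prod>j=1..k. gseq (if j \<in> c ` B then 1 else -1) umbral_E ((\<alpha> \<circ> c) j)) =
        (\<Prod>j=1..k. gseq (if c j \<in> c ` B then 1 else -1) umbral_E ((\<alpha> \<circ> c) (c j)))"
      using prod.reindex_bij_betw[OF bij, symmetric] .
    also have "\<dots> = (\<Prod>j=1..k. if j \<in> A then gseq (-1) umbral_E (\<alpha> j) else gseq 1 umbral_E (\<alpha> j))"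
      using memB c by (intro prod.cong) auto
    finally show "of_nat (num_rev_alt k \<alpha> A B) =
        umbral (psubst ((\<Prod>i\<in>A. sym_e (\<alpha> i)) * (\<Prod>j\<in>B. sym_h (\<alpha> j))) seq_plus)"
      unfolding subst psubst_seq_plus rev
      using num_alt_even[OF cAB cdisj, of "\<alpha> \<circ> c"] even sum_c by simp
  qed
qed

end
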